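(* Let $d\ge 1$, let $\mu$ be a strictly elliptic law on $\mathcal P_+$, and let $P_0$ be the annealed law of the associated random walk $(X_n)_{n\ge 0}$ in i.i.d. random environment on $\mathbb Z^d$ started at $0$. If $\nu$ and $\nu'$ are two distinct vectors in $S^{d-1}$ such that $P_0(B_\nu)\,P_0(B_{\nu'})>0$, then $\nu'=-\nu$.
   Context: Setting (random walk in i.i.d. random environment). $|\cdot|$ is the Euclidean norm, $S^{d-1}$ the Euclidean unit sphere of $\mathbb R^d$. $\mathcal P_+$ is the set of probability vectors $(p(e))_{e}$ indexed by the $2d$ unit vectors $e\in\mathbb Z^d$, $|e|=1$ (i.e. $p(e)\in[0,1]$, $\sum_e p(e)=1$). An environment is an element $\omega=(\omega_z)_{z\in\mathbb Z^d}$ of $\Omega=\mathcal P_+^{\mathbb Z^d}$. For fixed $\omega$ and $x\in\mathbb Z^d$, $P_{x,\omega}$ (the quenched law) is the law of the Markov chain $(X_n)_{n\ge0}$ on $\mathbb Z^d$ with $P_{x,\omega}(X_0=x)=1$ and $P_{x,\omega}(X_{n+1}=z+e\mid X_n=z)=\omega_z(e)$ for $z,e\in\mathbb Z^d$, $|e|=1$. Given a probability law $\mu$ on $\mathcal P_+$, set $\mathbb P=\mu^{\otimes\mathbb Z^d}$ on $\Omega$; the annealed law $P_x$ on $\Omega\times(\mathbb Z^d)^{\mathbb N}$ is the semi-product $P_x=\mathbb P\times P_{x,\omega}$. Strict ellipticity of $\mu$: for every $e\in\mathbb Z^d$ with $|e|=1$, $\omega_0(e)>0$ $\mathbb P$-almost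 surely. For $\nu\in S^{d-1}$, $B_\nu=\{\lim_{n\to\infty}X_n/|X_n|=\nu\}$. The value given to $X_n/|X_n|$ when $X_n=0$ is an arbitrary fixed convention (e.g. $0$). *)

theory Defs
  imports "HOL-Probability.Probability"
begin

definition real_vec :: "int ^ 'd \<Rightarrow> real ^ 'd" where
  "real_vec z = (\<chi> i. real_of_int (z $ i))"

definition unit_vecs :: "(int ^ 'd) set" where
  "unit_vecs = {e. norm (real_vec e) = 1}"

definition prob_vectors :: "(int ^ 'd \<Rightarrow> real) set" where
  "prob_vectors = {p \<in> unit_vecs \<rightarrow>\<^sub>E {0..1}. (\<Sum>e\<in>unit_vecs. p e) = 1}"

definition prob_vector_space :: "(int ^ 'd \<Rightarrow> real) measure" where
  "prob_vector_space = restrict_space (PiM unit_vecs (\<lambda>_. borel)) prob_vectors"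

type_synonym 'd env = "(int, 'd) vec \<Rightarrow> (int, 'd) vec \<Rightarrow> real"

abbreviation env_space :: "('d::finite) env measure" where
  "env_space \<equiv> PiM UNIV (\<lambda>_. prob_vector_space)"

abbreviation path_space :: "(nat \<Rightarrow> int ^ 'd) measure" where
  "path_space \<equiv> PiM UNIV (\<lambda>_. count_space UNIV)"

text \<open>Law of \<open>z + e\<close>, where the unit vector \<open>e\<close> is drawn according to \<open>\<omega> z\<close>.\<close>

definition step_law :: "('d::finite) env \<Rightarrow> int ^ 'd \<Rightarrow> (int ^ 'd) measure" where
  "step_law \<omega> z = density (count_space UNIV)
     (\<lambda>y. if y - z \<in> unit_vecs then ennreal (\<omega> z (y - z)) else 0)"

definition walk_kernel :: "('d::finite) env \<Rightarrow> int ^ 'd \<Rightarrow> nat \<Rightarrow> (nat \<Rightarrow> int ^ 'd) \<Rightarrow> (int ^ 'd) measure" where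
  "walk_kernel \<omega> x n h =
     (case n of 0 \<Rightarrow> return (count_space UNIV) x | Suc m \<Rightarrow> step_law \<omega> (h m))"

text \<open>
  \<open>walk_kernel \<omega> x n h\<close> is the conditional law of \<open>X n\<close> given the history
  \<open>X 0 = h 0, \<dots>, X (n - 1) = h (n - 1)\<close>. The quenched law is the Ionescu-Tulcea limit of
  these kernels; being defined inside a locale, the limit has to be referred to by the
  global constants below. The locale assumptions are met for environments in
  \<open>env_space\<close> (\<open>Ionescu_Tulcea_walk\<close>), and \<open>quenched_cylinder\<close> gives the
  resulting finite-dimensional distributions.
\<close>

definition quenched :: "('d::finite) env \<Rightarrow> int ^ 'd \<Rightarrow> (nat \<Rightarrow> int ^ 'd) measure" where
  "quenched \<omega> x = projective_family.lim UNIV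
     (Ionescu_Tulcea.CI (walk_kernel \<omega> x) (\<lambda>_. count_space UNIV)) (\<lambda>_. count_space UNIV)"

definition env_law :: "(int ^ 'd \<Rightarrow> real) measure \<Rightarrow> ('d::finite) env measure" where
  "env_law \<mu> = PiM UNIV (\<lambda>_. \<mu>)"

text \<open>
  The semi-product of the environment law and the quenched laws. For measurable \<open>A\<close> its
  value is the integral of \<open>quenched \<omega> x\<close> over the sections of \<open>A\<close>, see
  \<open>emeasure_annealed\<close>.
\<close>

definition annealed ::
    "(int ^ 'd \<Rightarrow> real) measure \<Rightarrow> int ^ 'd \<Rightarrow> (('d::finite) env \<times> (nat \<Rightarrow> int ^ 'd)) measure" where
  "annealed \<mu> x = env_law \<mu> \<bind>
     (\<lambda>\<omega>. distr (quenched \<omega> x) (env_space \<Otimes>\<^sub>M path_space) (\<lambda>X. (\<omega>, X)))"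

definition strictly_elliptic :: "(int ^ 'd \<Rightarrow> real) measure \<Rightarrow> bool" where
  "strictly_elliptic \<mu> \<longleftrightarrow> (\<forall>e\<in>unit_vecs. AE \<omega> in env_law \<mu>. 0 < \<omega> 0 e)"

text \<open>Convention: \<open>X n / |X n| = 0\<close> whenever \<open>X n = 0\<close>, since \<open>inverse 0 = 0\<close>.\<close>

definition limit_dir_event :: "real ^ 'd \<Rightarrow> (('d::finite) env \<times> (nat \<Rightarrow> int ^ 'd)) set" where
  "limit_dir_event \<nu> = {(\<omega>, X) \<in> space (env_space \<Otimes>\<^sub>M path_space).
     (\<lambda>n. real_vec (X n) /\<^sub>R norm (real_vec (X n))) \<longlonglongrightarrow> \<nu>}"

lemma finite_unit_vecs: "finite (unit_vecs :: (int ^ 'd) set)"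
proof -
  have "(unit_vecs :: (int ^ 'd) set) \<subseteq> vec_lambda ` (UNIV \<rightarrow>\<^sub>E {-1..1})"
  proof
    fix e :: "int ^ 'd" assume e: "e \<in> unit_vecs"
    have "\<bar>e $ i\<bar> \<le> 1" for i
    proof -
      have "\<bar>real_vec e $ i\<bar> \<le> norm (real_vec e)" by (rule component_le_norm_cart)
      then show ?thesis using e by (simp add: unit_vecs_def real_vec_def)
    qed
    then have "vec_nth e \<in> UNIV \<rightarrow>\<^sub>E {-1..1}" by (auto simp: abs_le_iff minus_le_iff)
    then show "e \<in> vec_lambda ` (UNIV \<rightarrow>\<^sub>E {-1..1})" by (metis image_eqI vec_nth_inverse)
  qed
  then show ?thesis
    by (rule finite_subset) (intro finite_imageI finite_PiE; simp)
qed

lemma unit_vecs_eq: "(unit_vecs :: (int ^ 'd) set) = (\<Union>i. {axis i 1, axis i (-1)})"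
proof (intro equalityI subsetI)
  fix e :: "int ^ 'd" assume e: "e \<in> unit_vecs"
  then have "(norm (real_vec e))\<^sup>2 = 1" by (simp add: unit_vecs_def)
  then have "(\<Sum>i\<in>UNIV. (real_of_int (e $ i))\<^sup>2) = 1"
    unfolding power2_norm_eq_inner by (simp add: inner_vec_def real_vec_def power2_eq_square)
  then have "real_of_int (\<Sum>i\<in>UNIV. (e $ i)\<^sup>2) = real_of_int 1" by simp
  then have s: "(\<Sum>i\<in>UNIV. (e $ i)\<^sup>2) = 1" by (simp only: of_int_eq_iff)
  then obtain i where i: "e $ i \<noteq> 0"
    by (metis (no_types, lifting) sum.neutral power_zero_numeral zero_neq_one)
  have sp: "(\<Sum>i\<in>UNIV. (e $ i)\<^sup>2) = (e $ i)\<^sup>2 + (\<Sum>j\<in>UNIV - {i}. (e $ j)\<^sup>2)"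
    by (rule sum.remove) auto
  have "(e $ i)\<^sup>2 \<ge> 1" using i by (simp add: int_one_le_iff_zero_less)
  moreover have nn: "0 \<le> (\<Sum>j\<in>UNIV - {i}. (e $ j)\<^sup>2)" by (intro sum_nonneg) auto
  ultimately have sq: "(e $ i)\<^sup>2 = 1" and z: "(\<Sum>j\<in>UNIV - {i}. (e $ j)\<^sup>2) = 0"
    using s sp by linarith+
  have "e $ j = 0" if "j \<noteq> i" for j
    using z that by (subst (asm) sum_nonneg_eq_0_iff) auto
  moreover have "e $ i = 1 \<or> e $ i = -1" using sq by (simp add: power2_eq_1_iff)
  ultimately have "e = axis i 1 \<or> e = axis i (-1)" by (auto simp: vec_eq_iff axis_def)
  then show "e \<in> (\<Union>i. {axis i 1, axis i (-1)})" by blast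
next
  fix e :: "int ^ 'd" assume "e \<in> (\<Union>i. {axis i 1, axis i (-1)})"
  then obtain i and c :: int where e: "e = axis i c" "\<bar>c\<bar> = 1" by auto
  have "real_vec e = real_of_int c *\<^sub>R axis i 1"
    by (auto simp: e real_vec_def axis_def vec_eq_iff)
  then have "norm (real_vec e) = real_of_int \<bar>c\<bar>" by simp
  then show "e \<in> unit_vecs" using e(2) by (simp add: unit_vecs_def)
qed

lemma space_prob_vector_space: "space prob_vector_space = prob_vectors"
  by (auto simp: prob_vector_space_def space_restrict_space space_PiM prob_vectors_def PiE_def)

lemma prob_space_step_law:
  assumes "\<omega> z \<in> prob_vectors"
  shows "prob_space (step_law \<omega> z)"
proof
  let ?f = "\<lambda>y. if y - z \<in> unit_vecs then ennreal (\<omega> z (y - z)) else 0"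
  have img: "{y. y - z \<in> unit_vecs} = (\<lambda>e. z + e) ` unit_vecs"
    by (auto simp: image_iff intro!: exI[of _ "_ - z"] bexI[of _ "_ - z"])
  have "emeasure (step_law \<omega> z) (space (step_law \<omega> z)) = (\<integral>\<^sup>+y. ?f y \<partial>count_space UNIV)"
    by (simp add: step_law_def emeasure_density)
  also have "\<dots> = (\<Sum>y\<in>(\<lambda>e. z + e) ` unit_vecs. ?f y)"
    by (rule nn_integral_count_space') (use img finite_unit_vecs in \<open>auto split: if_splits\<close>)
  also have "\<dots> = (\<Sum>e\<in>unit_vecs. ennreal (\<omega> z e))"
    by (subst sum.reindex) (auto simp: inj_on_def)
  also have "\<dots> = 1"
    using assms by (subst sum_ennreal) (auto simp: prob_vectors_def)
  finally show "emeasure (step_law \<omega> z) (space (step_law \<omega> z)) = 1" .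
qed

lemma Ionescu_Tulcea_walk:
  assumes "\<And>z. \<omega> z \<in> prob_vectors"
  shows "Ionescu_Tulcea (walk_kernel \<omega> x) (\<lambda>_. count_space UNIV)"
proof (rule Ionescu_Tulcea.intro)
  fix n :: nat
  have 1: "step_law \<omega> \<in> measurable (count_space UNIV) (subprob_algebra (count_space UNIV))"
    using assms
    by (auto simp: space_subprob_algebra prob_space_step_law prob_space_imp_subprob_space)
       (simp add: step_law_def)
  show "walk_kernel \<omega> x n \<in> measurable (PiM {0..<n} (\<lambda>_. count_space UNIV)) (subprob_algebra (count_space UNIV))"
  proof (cases n)
    case 0
    then show ?thesis
      by (simp add: walk_kernel_def[abs_def] space_subprob_algebra prob_space_return prob_space_imp_subprob_space)
  next
    case (Suc m)
    have "(\<lambda>h. h m) \<in> measurable (PiM {0..<n} (\<lambda>_. count_space UNIV)) (count_space UNIV)"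
      using Suc by (intro measurable_component_singleton) auto
    from measurable_compose[OF this 1] show ?thesis
      by (simp add: walk_kernel_def[abs_def] Suc)
  qed
next
  fix n :: nat and h
  show "prob_space (walk_kernel \<omega> x n h)"
    using assms by (cases n) (auto simp: walk_kernel_def prob_space_return prob_space_step_law)
qed

lemma sets_quenched:
  assumes "\<And>z. \<omega> z \<in> prob_vectors"
  shows "sets (quenched \<omega> x) = sets path_space"
proof -
  interpret Ionescu_Tulcea "walk_kernel \<omega> x" "\<lambda>_. count_space UNIV"
    using assms by (rule Ionescu_Tulcea_walk)
  show ?thesis by (simp add: quenched_def)
qed

lemma prob_space_quenched:
  assumes "\<And>z. \<omega> z \<in> prob_vectors"
  shows "prob_space (quenched \<omega> x)"
proof -
  interpret Ionescu_Tulcea "walk_kernel \<omega> x" "\<lambda>_. count_space UNIV"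
    using assms by (rule Ionescu_Tulcea_walk)
  have "emeasure PF.lim (PF.emb UNIV {} {\<lambda>_. undefined}) = emeasure (CI {}) {\<lambda>_. undefined}"
    by (rule lim) (auto simp: PiM_empty)
  also have "\<dots> = 1"
    using prob_space.emeasure_space_1[OF PF.prob_space_P[of "{}"]] by (simp add: PF.space_P space_PiM_empty)
  also have "PF.emb UNIV {} {\<lambda>_. undefined} = space PF.lim"
    by (auto simp: prod_emb_def space_PiM restrict_def)
  finally show ?thesis
    unfolding quenched_def by (rule prob_spaceI)
qed

lemma quenched_cylinder:
  assumes \<omega>: "\<And>z. \<omega> z \<in> prob_vectors"
  shows "emeasure (quenched \<omega> x) {X. \<forall>i\<le>n. X i = y i} =
    (if y 0 = x then 1 else 0) * (\<Prod>i<n. if y (Suc i) - y i \<in> unit_vecs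
        then ennreal (\<omega> (y i) (y (Suc i) - y i)) else 0)"
proof -
  let ?M = "\<lambda>_::nat. count_space UNIV :: (int ^ 'd) measure"
  interpret Ionescu_Tulcea "walk_kernel \<omega> x" ?M
    using \<omega> by (rule Ionescu_Tulcea_walk)
  let ?S = "\<lambda>n. {restrict y {0..<n}}"
  have S_eq: "?S n = PiE {0..<n} (\<lambda>i. {y i})" for n
    by (auto simp: PiE_iff fun_eq_iff extensional_def restrict_def)
  have S[measurable]: "?S n \<in> sets (PiM {0..<n} ?M)" for n
    unfolding S_eq by (intro sets_PiM_I_finite) auto
  let ?u = "(\<lambda>_. undefined) :: nat \<Rightarrow> int ^ 'd"
  have u: "?u \<in> space (PiM {0..<0} ?M)" by simp
  have rec: "emeasure (C 0 (Suc m) ?u) (?S (Suc m)) =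
     emeasure (C 0 m ?u) (?S m) * emeasure (walk_kernel \<omega> x m y) {y m}" for m
  proof -
    have "emeasure (C 0 (Suc m) ?u) (?S (Suc m)) = (\<integral>\<^sup>+h. emeasure (eP m h) (?S (Suc m)) \<partial>C 0 m ?u)"
      unfolding C.simps add_0
      by (rule emeasure_bind[where N="PiM {0..<Suc m} ?M"])
         (use prob_space.not_empty[OF prob_space_C[OF u]] in
           \<open>auto simp: measurable_cong_sets[OF sets_C[OF u] refl]\<close>)
    also have "\<dots> = (\<integral>\<^sup>+h. emeasure (walk_kernel \<omega> x m y) {y m} * indicator (?S m) h \<partial>C 0 m ?u)"
    proof (rule nn_integral_cong)
      fix h assume "h \<in> space (C 0 m ?u)"
      then have h: "h \<in> space (PiM {0..<m} ?M)" using space_C[OF u, of m] by simp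
      then have he: "h \<in> extensional {0..<m}" by (simp add: space_PiM PiE_def)
      have wk: "walk_kernel \<omega> x m (restrict y {0..<m}) = walk_kernel \<omega> x m y"
        by (cases m) (auto simp: walk_kernel_def)
      have upd: "h(m := v) = restrict y {0..<Suc m} \<longleftrightarrow> h = restrict y {0..<m} \<and> v = y m" for v
      proof
        assume *: "h(m := v) = restrict y {0..<Suc m}"
        have "h j = restrict y {0..<m} j" for j
          using fun_cong[OF *, of j] he by (cases "j < m") (auto simp: extensional_def)
        with fun_cong[OF *, of m] show "h = restrict y {0..<m} \<and> v = y m" by auto
      next
        assume "h = restrict y {0..<m} \<and> v = y m"
        then show "h(m := v) = restrict y {0..<Suc m}" by (auto simp: fun_eq_iff)
      qed
      have pre: "(\<lambda>v. h(m := v)) -` ?S (Suc m) \<inter> UNIV = (if h = restrict y {0..<m} then {y m} else {})"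
        unfolding vimage_def singleton_iff upd by auto
      show "emeasure (eP m h) (?S (Suc m)) = emeasure (walk_kernel \<omega> x m y) {y m} * indicator (?S m) h"
        using wk by (auto simp only: emeasure_eP[OF h S] space_count_space pre split: split_indicator if_splits) auto
    qed
    also have "\<dots> = emeasure (walk_kernel \<omega> x m y) {y m} * emeasure (C 0 m ?u) (?S m)"
      by (rule nn_integral_cmult_indicator) (simp add: sets_C[OF u] S[simplified])
    finally show ?thesis by (simp add: mult.commute)
  qed
  have step: "emeasure (step_law \<omega> z) {v} = (if v - z \<in> unit_vecs then ennreal (\<omega> z (v - z)) else 0)" for z v
    by (simp add: step_law_def emeasure_density nn_integral_count_space_indicator[symmetric]
        nn_integral_count_space_finite)
  have C0: "emeasure (C 0 0 ?u) (?S 0) = 1"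
    by (simp add: restrict_def PiM_empty)
  have main: "emeasure (C 0 (Suc n) ?u) (?S (Suc n)) =
    (if y 0 = x then 1 else 0) * (\<Prod>i<n. if y (Suc i) - y i \<in> unit_vecs
        then ennreal (\<omega> (y i) (y (Suc i) - y i)) else 0)" for n
  proof (induction n)
    case 0
    show ?case unfolding rec[of 0] C0 by (auto simp: walk_kernel_def)
  next
    case (Suc n)
    show ?case unfolding rec[of "Suc n"] Suc by (simp add: walk_kernel_def step mult.assoc)
  qed
  have "{X. \<forall>i\<le>n. X i = y i} = PF.emb UNIV {0..<Suc n} (?S (Suc n))"
    by (simp add: prod_emb_def space_PiM fun_eq_iff restrict_def less_Suc_eq_le set_eq_iff)
  then have "emeasure (quenched \<omega> x) {X. \<forall>i\<le>n. X i = y i} = emeasure (CI {0..<Suc n}) (?S (Suc n))"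
    unfolding quenched_def by (simp only: lim[OF _ S] finite_atLeastLessThan)
  also have "\<dots> = emeasure (C 0 (Suc n) ?u) (PF.emb {0..<Suc n} {0..<Suc n} (?S (Suc n)))"
    by (rule emeasure_CI) (auto simp only: S subset_refl)
  also have "PF.emb {0..<Suc n} {0..<Suc n} (?S (Suc n)) = ?S (Suc n)"
    by (rule prod_emb_id) (auto simp: PiE_iff)
  finally show ?thesis using main by simp
qed

lemma measurable_env_component:
  assumes "e \<in> unit_vecs"
  shows "(\<lambda>\<omega>. \<omega> z e) \<in> borel_measurable env_space"
proof -
  have 1: "(\<lambda>\<omega>. \<omega> z) \<in> measurable env_space prob_vector_space"
    by (rule measurable_component_singleton) simp
  have 2: "(\<lambda>p. p e) \<in> borel_measurable prob_vector_space"
    unfolding prob_vector_space_def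
    by (intro measurable_restrict_space1 measurable_component_singleton assms)
  show ?thesis using measurable_compose[OF 1 2] .
qed

lemma space_env_space: "\<omega> \<in> space env_space \<longleftrightarrow> (\<forall>z. \<omega> z \<in> prob_vectors)"
  by (auto simp: space_PiM space_prob_vector_space PiE_iff)

lemma measurable_quenched:
  fixes x :: "int ^ 'd"
  shows "(\<lambda>\<omega>. quenched \<omega> x) \<in> measurable env_space (prob_algebra path_space)"
proof (rule measurable_prob_algebra_generated[OF sets_PiM Int_stable_prod_algebra prod_algebra_sets_into_space])
  show "prob_space (quenched \<omega> x)" if "\<omega> \<in> space env_space" for \<omega>
    using that by (intro prob_space_quenched) (simp add: space_env_space)
  show "sets (quenched \<omega> x) = sets path_space" if "\<omega> \<in> space env_space" for \<omega>
    using that by (intro sets_quenched) (simp add: space_env_space)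
  fix A :: "(nat \<Rightarrow> int ^ 'd) set"
  assume "A \<in> prod_algebra UNIV (\<lambda>_. count_space UNIV)"
  then obtain J E where A: "A = prod_emb UNIV (\<lambda>_. count_space UNIV) J (PiE J E)" and J: "finite J"
    by (auto elim!: prod_algebraE)
  from J obtain n where n: "J \<subseteq> {..n}" by (meson finite_nat_iff_bounded_le)
  define Y where "Y = {y \<in> PiE {..n} (\<lambda>_. UNIV :: (int ^ 'd) set). \<forall>j\<in>J. y j \<in> E j}"
  define cyl where "cyl y = {X :: nat \<Rightarrow> int ^ 'd. \<forall>i\<le>n. X i = y i}" for y
  have cntY: "countable Y"
    unfolding Y_def
    by (rule countable_subset[OF _ countable_PiE[of "{..n}" "\<lambda>_. UNIV"]]) blast+
  have AY: "A = (\<Union>y\<in>Y. cyl y)"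
  proof (intro equalityI subsetI)
    fix X assume X: "X \<in> A"
    have "restrict X {..n} \<in> Y" "X \<in> cyl (restrict X {..n})"
      using X n by (auto simp: A Y_def cyl_def prod_emb_def PiE_iff)
    then show "X \<in> (\<Union>y\<in>Y. cyl y)" by blast
  next
    fix X assume "X \<in> (\<Union>y\<in>Y. cyl y)"
    then show "X \<in> A" using n by (force simp: A Y_def cyl_def prod_emb_def PiE_iff space_PiM)
  qed
  have disj: "disjoint_family_on cyl Y"
    unfolding disjoint_family_on_def
  proof (intro ballI impI)
    fix y y' assume y: "y \<in> Y" "y' \<in> Y" "y \<noteq> y'"
    show "cyl y \<inter> cyl y' = {}"
    proof (rule ccontr)
      assume "cyl y \<inter> cyl y' \<noteq> {}"
      then have "\<forall>i\<le>n. y i = y' i" by (auto simp: cyl_def)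
      then have "y = y'" using y(1,2) by (intro PiE_ext[of _ "{..n}" "\<lambda>_. UNIV"]) (auto simp: Y_def)
      with y(3) show False ..
    qed
  qed
  have cyl_sets: "cyl y \<in> sets path_space" for y
  proof -
    have "cyl y = prod_emb UNIV (\<lambda>_. count_space UNIV) {..n} (PiE {..n} (\<lambda>i. {y i}))"
      by (auto simp: cyl_def prod_emb_def space_PiM PiE_iff)
    also have "\<dots> \<in> sets path_space" by (intro sets_PiM_I) auto
    finally show ?thesis .
  qed
  let ?f = "\<lambda>y \<omega>. (if y 0 = x then 1 else 0) * (\<Prod>i<n. if y (Suc i) - y i \<in> unit_vecs
        then ennreal (\<omega> (y i) (y (Suc i) - y i)) else 0)"
  have "emeasure (quenched \<omega> x) A = (\<integral>\<^sup>+y. ?f y \<omega> \<partial>count_space Y)" if "\<omega> \<in> space env_space" for \<omega>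
  proof -
    have \<omega>: "\<omega> z \<in> prob_vectors" for z using that by (simp add: space_env_space)
    have "emeasure (quenched \<omega> x) A = (\<integral>\<^sup>+y. emeasure (quenched \<omega> x) (cyl y) \<partial>count_space Y)"
      unfolding AY using cntY disj cyl_sets
      by (intro emeasure_UN_countable) (auto simp: sets_quenched[OF \<omega>])
    also have "\<dots> = (\<integral>\<^sup>+y. ?f y \<omega> \<partial>count_space Y)"
      unfolding cyl_def by (simp only: quenched_cylinder[OF \<omega>])
    finally show ?thesis .
  qed
  moreover have "(\<lambda>\<omega>. \<integral>\<^sup>+y. ?f y \<omega> \<partial>count_space Y) \<in> borel_measurable env_space"
  proof -
    interpret sigma_finite_measure "count_space Y" using cntY by (rule sigma_finite_measure_count_space_countable)
    have m: "?f y \<in> borel_measurable env_space" for y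
    proof -
      have "(\<lambda>\<omega>. if e \<in> unit_vecs then ennreal (\<omega> z e) else 0) \<in> borel_measurable env_space"
        for z e :: "int ^ 'd"
        using measurable_env_component[of e z] by (cases "e \<in> unit_vecs") auto
      then show ?thesis by (intro borel_measurable_times_ennreal borel_measurable_prod_ennreal borel_measurable_const)
    qed
    have "(\<lambda>(y, \<omega>). ?f y \<omega>) \<in> borel_measurable (count_space Y \<Otimes>\<^sub>M env_space)"
      using cntY m by (intro measurable_pair_measure_countable1) (auto simp only: prod.case)
    from measurable_pair_swap[OF this] show ?thesis
      by (intro borel_measurable_nn_integral) (simp only: split_beta' fst_conv snd_conv)
  qed
  ultimately show "(\<lambda>\<omega>. emeasure (quenched \<omega> x) A) \<in> borel_measurable env_space"
    by (simp cong: measurable_cong)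
qed

context
  fixes \<mu> :: "(int ^ 'd \<Rightarrow> real) measure"
  assumes \<mu>: "prob_space \<mu>" "sets \<mu> = sets prob_vector_space"
begin

lemma sets_env_law: "sets (env_law \<mu>) = sets env_space"
  unfolding env_law_def by (rule sets_PiM_cong) (auto simp: \<mu>)

lemma prob_space_env_law: "prob_space (env_law \<mu>)"
  unfolding env_law_def by (rule prob_space_PiM) (rule \<mu>)

lemma measurable_annealed_kernel:
  "(\<lambda>\<omega>. distr (quenched \<omega> x) (env_space \<Otimes>\<^sub>M path_space) (\<lambda>X. (\<omega>, X)))
     \<in> measurable (env_law \<mu>) (prob_algebra (env_space \<Otimes>\<^sub>M path_space))"
proof -
  have q: "(\<lambda>\<omega>. quenched \<omega> x) \<in> measurable (env_law \<mu>) (prob_algebra path_space)"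
    using measurable_quenched by (simp cong: measurable_cong_sets[OF sets_env_law refl])
  have "(\<lambda>(\<omega>, X). (\<omega>, X)) \<in> measurable (env_law \<mu> \<Otimes>\<^sub>M path_space) (env_space \<Otimes>\<^sub>M path_space)"
    by (simp add: measurable_cong_sets[OF sets_pair_measure_cong[OF sets_env_law refl] refl])
  with q show ?thesis by (intro measurable_distr_prob_space2)
qed

lemma prob_space_annealed: "prob_space (annealed \<mu> x)"
  unfolding annealed_def
  by (rule prob_space_bind'[OF _ measurable_annealed_kernel])
     (simp add: space_prob_algebra prob_space_env_law)

lemma sets_annealed: "sets (annealed \<mu> x) = sets (env_space \<Otimes>\<^sub>M path_space)"
  unfolding annealed_def
  by (rule sets_bind'[OF _ measurable_annealed_kernel])
     (simp add: space_prob_algebra prob_space_env_law)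

lemma emeasure_annealed:
  assumes A: "A \<in> sets (env_space \<Otimes>\<^sub>M path_space)"
  shows "emeasure (annealed \<mu> x) A = (\<integral>\<^sup>+\<omega>. emeasure (quenched \<omega> x) (Pair \<omega> -` A) \<partial>env_law \<mu>)"
proof -
  have "emeasure (annealed \<mu> x) A = (\<integral>\<^sup>+\<omega>. emeasure
      (distr (quenched \<omega> x) (env_space \<Otimes>\<^sub>M path_space) (\<lambda>X. (\<omega>, X))) A \<partial>env_law \<mu>)"
    unfolding annealed_def
    by (rule emeasure_bind_prob_algebra[OF _ measurable_annealed_kernel A])
       (simp add: space_prob_algebra prob_space_env_law)
  also have "\<dots> = (\<integral>\<^sup>+\<omega>. emeasure (quenched \<omega> x) (Pair \<omega> -` A) \<partial>env_law \<mu>)"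
  proof (rule nn_integral_cong)
    fix \<omega> assume "\<omega> \<in> space (env_law \<mu>)"
    then have \<omega>: "\<omega> \<in> space env_space" by (simp only: sets_eq_imp_space_eq[OF sets_env_law])
    then have s: "sets (quenched \<omega> x) = sets path_space"
      by (intro sets_quenched) (simp add: space_env_space)
    have "(\<lambda>X. (\<omega>, X)) \<in> measurable (quenched \<omega> x) (env_space \<Otimes>\<^sub>M path_space)"
      using measurable_Pair1'[OF \<omega>] by (simp cong: measurable_cong_sets[OF s refl])
    moreover have "space (quenched \<omega> x) = UNIV"
      using sets_eq_imp_space_eq[OF s] by (simp add: space_PiM)
    ultimately show "emeasure (distr (quenched \<omega> x) (env_space \<Otimes>\<^sub>M path_space) (\<lambda>X. (\<omega>, X))) A =
        emeasure (quenched \<omega> x) (Pair \<omega> -` A)"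
      using A by (simp add: emeasure_distr)
  qed
  finally show ?thesis .
qed

end

lemma sets_limit_dir_event: "limit_dir_event \<nu> \<in> sets (env_space \<Otimes>\<^sub>M path_space)"
proof -
  have f: "(\<lambda>w. real_vec (snd w n) /\<^sub>R norm (real_vec (snd w n))) \<in> borel_measurable (env_space \<Otimes>\<^sub>M path_space)" for n
  proof -
    have "(\<lambda>X. X n) \<in> measurable path_space (count_space UNIV)"
      by (rule measurable_component_singleton) simp
    then have "(\<lambda>w. snd w n) \<in> measurable (env_space \<Otimes>\<^sub>M path_space) (count_space UNIV)"
      by (rule measurable_compose[OF measurable_snd])
    then show ?thesis by (rule measurable_compose) simp
  qed
  have "limit_dir_event \<nu> = {w \<in> space (env_space \<Otimes>\<^sub>M path_space).
     (\<lambda>n. dist (real_vec (snd w n) /\<^sub>R norm (real_vec (snd w n))) \<nu>) \<longlonglongrightarrow> 0}"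
    unfolding limit_dir_event_def by (subst tendsto_dist_iff) auto
  also have "\<dots> \<in> sets (env_space \<Otimes>\<^sub>M path_space)"
    using f by measurable
  finally show ?thesis .
qed

end

theory Submission
  imports Defs
begin

text \<open>
  Suppose that \<open>\<nu>' \<noteq> - \<nu>\<close> and put \<open>l = \<nu> + \<nu>'\<close>, so that \<open>l \<bullet> \<nu> > 0\<close> and
  \<open>l \<bullet> \<nu>' > 0\<close>. Ellipticity forces a walk that returns infinitely often to one site to
  return infinitely often to every site of each line through it, so a walk with an asymptotic
  direction a.s. tends to infinity. If \<open>\<nu>'\<close> has positive probability, then decomposing at a
  minimum of \<open>l \<bullet> X n\<close> shows that with some probability \<open>\<delta> > 0\<close> the walk has direction
  \<open>\<nu>'\<close> and never goes below its starting level in direction \<open>l\<close>. Whenever \<open>l \<bullet> X n\<close> is a strict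
  record, the environment at and above the current level is independent of the past, so the
  conditional probability of then taking direction \<open>\<nu>'\<close> is at least \<open>\<delta>\<close>. On the event of
  direction \<open>\<nu>\<close> there are infinitely many records, hence by a weak form of Levy's zero-one
  law this event, which is disjoint from that of direction \<open>\<nu>'\<close>, is null.
\<close>

subsection \<open>Cylinders in sequence space\<close>

text \<open>Prefixes are lists, so that concatenation of paths and first prefixes with a given
  property become list operations.\<close>

definition cylinder :: "'a list \<Rightarrow> (nat \<Rightarrow> 'a) set" where
  "cylinder w = {X. \<forall>i<length w. X i = w ! i}"

abbreviation seq_space :: "(nat \<Rightarrow> 'a) measure" where
  "seq_space \<equiv> PiM UNIV (\<lambda>_. count_space UNIV)"

lemma cylinder_iff: "X \<in> cylinder w \<longleftrightarrow> map X [0..<length w] = w"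
  unfolding cylinder_def by (subst list_eq_iff_nth_eq) simp

lemma cylinder_prefix: "X \<in> cylinder (map X [0..<n])"
  by (simp add: cylinder_def)

lemma cylinder_Nil [simp]: "cylinder [] = UNIV"
  by (simp add: cylinder_def)

lemma cylinder_append:
  "X \<in> cylinder (u @ v) \<longleftrightarrow> X \<in> cylinder u \<and> (\<lambda>k. X (length u + k)) \<in> cylinder v"
  by (auto simp: cylinder_def nth_append)
     (metis add_diff_inverse_nat nat_add_left_cancel_less)

lemma cylinder_disjoint:
  assumes "length u \<le> length v" "take (length u) v \<noteq> u"
  shows "cylinder u \<inter> cylinder v = {}"
proof (rule ccontr)
  assume "cylinder u \<inter> cylinder v \<noteq> {}"
  then obtain X where "X \<in> cylinder u" "X \<in> cylinder v" by blast
  then have "take (length u) v = u" using assms(1)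
    unfolding cylinder_def by (intro nth_equalityI) auto
  then show False using assms(2) by simp
qed

text \<open>Two cylinders are nested or disjoint, according to whether the shorter word is a prefix
  of the longer one. The empty set is added to the family for the disjoint case.\<close>

lemma Int_stable_cylinder: "Int_stable (insert {} (range cylinder))"
proof -
  have *: "cylinder u \<inter> cylinder v \<in> insert {} (range cylinder)"
    if "length u \<le> length v" for u v :: "'a list"
  proof (cases "take (length u) v = u")
    case True
    then have "v = u @ drop (length u) v" by (metis append_take_drop_id)
    then have "cylinder v \<subseteq> cylinder u" by (metis cylinder_append subsetI)
    then show ?thesis by (simp add: Int_absorb1)
  next
    case False
    then show ?thesis using cylinder_disjoint[OF that] by simp
  qed
  then have "cylinder u \<inter> cylinder v \<in> insert {} (range cylinder)" for u v :: "'a list"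
    using *[of u v] *[of v u] by (metis Int_commute nat_le_linear)
  then show ?thesis unfolding Int_stable_def by auto
qed

lemma cylinder_sets [measurable, simp]: "cylinder w \<in> sets seq_space"
proof -
  have "cylinder w = {X \<in> space seq_space. \<forall>i<length w. X i = w ! i}"
    by (simp add: cylinder_def space_PiM)
  also have "\<dots> \<in> sets seq_space" by measurable
  finally show ?thesis .
qed

lemma space_seq_space [simp]: "space (seq_space :: (nat \<Rightarrow> 'a) measure) = UNIV"
  by (simp add: space_PiM)

lemma prefix_event_eq: "{X. map X [0..<n] \<in> S} = (\<Union>w\<in>{w\<in>S. length w = n}. cylinder w)"
  by (auto simp: cylinder_iff)

lemma UN_cylinder_sets [simp]:
  "(\<Union>w\<in>W. cylinder w) \<in> sets (seq_space :: (nat \<Rightarrow> 'a::countable) measure)"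
  by (intro sets.countable_UN'') auto

text \<open>Countability of the state type enters here: an event about \<open>X i\<close> is a
  countable union of cylinders of length \<open>Suc i\<close>.\<close>

lemma sets_seq_space_cylinder:
  "sets (seq_space :: (nat \<Rightarrow> 'a::countable) measure) = sigma_sets UNIV (insert {} (range cylinder))"
    (is "_ = ?S")
proof (intro equalityI)
  show "?S \<subseteq> sets seq_space"
    using sets.sigma_sets_subset[of "insert {} (range cylinder)" "seq_space :: (nat \<Rightarrow> 'a) measure"]
    unfolding space_seq_space by (simp add: image_subset_iff)
  interpret S: sigma_algebra UNIV ?S by (rule sigma_algebra_sigma_sets) simp
  have "{X. X i \<in> A} \<in> ?S" for i and A :: "'a set"
  proof -
    have "{X. X i \<in> A} = {X. map X [0..<Suc i] \<in> {w. last w \<in> A}}" by simp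
    also have "\<dots> = (\<Union>w\<in>{w \<in> {w. last w \<in> A}. length w = Suc i}. cylinder w)"
      by (rule prefix_event_eq)
    also have "\<dots> \<in> ?S" by (intro S.countable_UN'') auto
    finally show ?thesis .
  qed
  then show "sets seq_space \<subseteq> ?S"
    unfolding sets_PiM_single by (auto intro!: S.sigma_sets_subset)
qed

text \<open>Uniqueness on an intersection-stable generator. The exhausting sequence is constantly
  \<open>cylinder []\<close>, so equality of the total masses is the case of the empty word.\<close>

lemma measure_eqI_cylinder:
  fixes M N :: "(nat \<Rightarrow> 'a::countable) measure"
  assumes "finite_measure M" "sets M = sets seq_space" "sets N = sets seq_space"
    and "\<And>w. emeasure M (cylinder w) = emeasure N (cylinder w)"
  shows "M = N"
proof (rule measure_eqI_generator_eq[OF Int_stable_cylinder, where \<Omega> = UNIV and A = "\<lambda>_. cylinder []"])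
  show "emeasure M (cylinder []) \<noteq> \<infinity>"
    using finite_measure.emeasure_finite[OF assms(1)] by simp
  show "range (\<lambda>_. cylinder []) \<subseteq> insert {} (range cylinder)" by blast
qed (use assms(2-) sets_seq_space_cylinder[where 'a='a] in auto)

text \<open>The sets that prefix events approximate in measure contain the cylinders and are closed
  under complements and countable unions; induction over the generated sigma-algebra then reaches
  every measurable set.\<close>

lemma prefix_event_approx:
  fixes M :: "(nat \<Rightarrow> 'a::countable) measure"
  assumes "finite_measure M" and M: "sets M = sets seq_space" and A: "A \<in> sets M" and "e > 0"
  obtains n S where "measure M ((A - {X. map X [0..<n] \<in> S}) \<union> ({X. map X [0..<n] \<in> S} - A)) < e"
proof -
  interpret finite_measure M by fact
  let ?F = "\<lambda>n S. {X :: nat \<Rightarrow> 'a. map X [0..<n] \<in> S}"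
  let ?d = "\<lambda>A B. measure M ((A - B) \<union> (B - A))"
  have F[measurable]: "?F n S \<in> sets M" for n S
    unfolding prefix_event_eq M by simp
  have "A \<in> sigma_sets UNIV (insert {} (range cylinder))"
    using A M sets_seq_space_cylinder by metis
  then have "\<forall>e>0. \<exists>n S. ?d A (?F n S) < e"
  proof (induction)
    case (Basic A)
    have "\<exists>n S. A = ?F n S"
    proof (cases "A = {}")
      case True
      then show ?thesis by (intro exI[of _ 0] exI[of _ "{}"]) simp
    next
      case False
      with Basic obtain w where "A = cylinder w" by auto
      then show ?thesis by (intro exI[of _ "length w"] exI[of _ "{w}"]) (auto simp: cylinder_iff)
    qed
    then show ?case by (metis Diff_cancel Un_absorb measure_empty)
  next
    case Empty
    show ?case by (auto intro!: exI[of _ "{}"])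
  next
    case (Compl A)
    show ?case
    proof (intro allI impI)
      fix e :: real assume "e > 0"
      with Compl obtain n S where "?d A (?F n S) < e" by blast
      moreover have "(UNIV - A - ?F n (- S)) \<union> (?F n (- S) - (UNIV - A)) =
          (A - ?F n S) \<union> (?F n S - A)" by auto
      ultimately show "\<exists>n S. ?d (UNIV - A) (?F n S) < e" by metis
    qed
  next
    case (Union a)
    have a[measurable]: "a i \<in> sets M" for i
      using Union.hyps M sets_seq_space_cylinder by metis
    show ?case
    proof (intro allI impI)
      fix e :: real assume e: "e > 0"
      define U where "U k = (\<Union>i\<le>k. a i)" for k
      have U[measurable]: "U k \<in> sets M" for k unfolding U_def by measurable
      have "incseq U" unfolding incseq_def U_def by force
      moreover have UU: "(\<Union>k. U k) = (\<Union>i. a i)" by (auto simp: U_def)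
      ultimately have "(\<lambda>k. measure M (U k)) \<longlonglongrightarrow> measure M (\<Union>i. a i)"
        using finite_Lim_measure_incseq[of U] U by (simp add: image_subset_iff)
      then obtain k where "dist (measure M (U k)) (measure M (\<Union>i. a i)) < e / 2"
        using e by (metis half_gt_zero lim_sequentially order_refl)
      moreover have "measure M ((\<Union>i. a i) - U k) = measure M (\<Union>i. a i) - measure M (U k)"
        by (rule finite_measure_Diff) (auto simp: U_def)
      ultimately have k: "measure M ((\<Union>i. a i) - U k) < e / 2"
        by (auto simp: dist_real_def abs_if split: if_splits)
      \<comment> \<open>Half of \<open>e\<close> pays for truncating the union at \<open>k\<close>;
        the other half is shared equally by the \<open>Suc k\<close> approximations.\<close>
      define e' where "e' = e / 2 / real (Suc k)"
      have "e' > 0" using e by (simp add: e'_def)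
      then have "\<forall>i. \<exists>n S. ?d (a i) (?F n S) < e'" using Union.IH by blast
      then obtain n S where nS: "\<And>i. ?d (a i) (?F (n i) (S i)) < e'" by metis
      \<comment> \<open>Prefixes of the various lengths \<open>n i\<close> are all read off from one
        prefix of the common length \<open>N\<close>.\<close>
      define N where "N = Max (n ` {..k})"
      have N: "n i \<le> N" if "i \<le> k" for i using that by (simp add: N_def)
      define T where "T = {w. \<exists>i\<le>k. take (n i) w \<in> S i}"
      have FT: "?F N T = (\<Union>i\<le>k. ?F (n i) (S i))"
      proof -
        have "take (n i) (map X [0..<N]) = map X [0..<n i]" if "i \<le> k" for i and X :: "nat \<Rightarrow> 'a"
          using N[OF that] by (simp add: take_map)
        then show ?thesis by (auto simp: T_def)
      qed
      have "?d (\<Union>i. a i) (?F N T) \<le> measure M (((\<Union>i. a i) - U k) \<union>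
          (\<Union>i\<le>k. (a i - ?F (n i) (S i)) \<union> (?F (n i) (S i) - a i)))"
        unfolding FT by (rule finite_measure_mono) (auto simp: U_def)
      also have "\<dots> \<le> measure M ((\<Union>i. a i) - U k) +
          measure M (\<Union>i\<le>k. (a i - ?F (n i) (S i)) \<union> (?F (n i) (S i) - a i))"
        by (rule measure_Un_le) auto
      finally have "?d (\<Union>i. a i) (?F N T) \<le> \<dots>" .
      moreover have "measure M (\<Union>i\<le>k. (a i - ?F (n i) (S i)) \<union> (?F (n i) (S i) - a i)) \<le>
          (\<Sum>i\<le>k. ?d (a i) (?F (n i) (S i)))"
        by (rule measure_UNION_le) auto
      moreover have "\<dots> \<le> (\<Sum>i\<le>k. e')" using nS by (intro sum_mono) (simp add: less_imp_le)
      moreover have "\<dots> = e / 2" by (simp add: e'_def divide_simps del: of_nat_Suc)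
      ultimately have "?d (\<Union>i. a i) (?F N T) < e" using k by linarith
      then show "\<exists>n S. ?d (\<Union>i. a i) (?F n S) < e" by blast
    qed
  qed
  then show thesis using that \<open>e > 0\<close> by blast
qed

text \<open>
  This replaces Levy's zero-one law: up to a small error \<open>E\<close> is decided by a finite prefix, but
  after any such prefix the path still reaches a state in \<open>R\<close>, from which it leaves \<open>E\<close> with
  conditional probability at least \<open>\<delta>\<close>.
\<close>

lemma prefix_zero_law:
  fixes M :: "(nat \<Rightarrow> 'a::countable) measure"
  assumes fin: "finite_measure M" and M: "sets M = sets seq_space" and E: "E \<in> sets M" and "\<delta> > 0"
    and inf: "\<And>X N. X \<in> E \<Longrightarrow> \<exists>n\<ge>N. R (map X [0..<n])"
    and exit: "\<And>w. R w \<Longrightarrow> \<delta> * measure M (cylinder w) \<le> measure M (cylinder w - E)"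
  shows "measure M E = 0"
proof -
  interpret finite_measure M by fact
  have cyl[measurable]: "cylinder w \<in> sets M" for w by (simp add: M)
  \<comment> \<open>Let the prefix event \<open>?F\<close> differ from \<open>E\<close> by less than
    \<open>e\<close>. The cylinders over \<open>W\<close> lie in \<open>?F\<close> and cover
    \<open>E \<inter> ?F\<close>; a share of at least \<open>\<delta>\<close> of their mass lies in
    \<open>?F - E\<close>, so this mass is at most \<open>e / \<delta>\<close>.\<close>
  have bound: "\<delta> * (measure M E - e) \<le> e" if e: "e > 0" for e
  proof -
    obtain n S where nS: "measure M ((E - {X. map X [0..<n] \<in> S}) \<union> ({X. map X [0..<n] \<in> S} - E)) < e"
      using prefix_event_approx[OF fin M E e] .
    let ?F = "{X. map X [0..<n] \<in> S}"
    have F[measurable]: "?F \<in> sets M" unfolding prefix_event_eq M by simp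
    \<comment> \<open>The words at which \<open>R\<close> holds for the first time from length
      \<open>n\<close> on. Minimality makes their cylinders disjoint, so that the exit estimate can
      be summed over them.\<close>
    define W where "W = {w. n \<le> length w \<and> take n w \<in> S \<and> R w \<and> (\<forall>k. n \<le> k \<longrightarrow> k < length w \<longrightarrow> \<not> R (take k w))}"
    let ?C = "\<Union>w\<in>W. cylinder w"
    have C[measurable]: "?C \<in> sets M" by (simp add: M)
    have disj: "disjoint_family_on cylinder W"
    proof -
      have *: "cylinder u \<inter> cylinder v = {}" if uv: "u \<in> W" "v \<in> W" "u \<noteq> v" "length u \<le> length v" for u v
      proof (cases "length u = length v")
        case True
        then show ?thesis using uv by (intro cylinder_disjoint) auto
      next
        case False
        then show ?thesis using uv by (intro cylinder_disjoint) (auto simp: W_def)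
      qed
      show ?thesis unfolding disjoint_family_on_def
        using * by (metis Int_commute nat_le_linear)
    qed
    have CF: "?C \<subseteq> ?F"
    proof
      fix X assume "X \<in> ?C"
      then obtain w where w: "w \<in> W" "map X [0..<length w] = w" by (auto simp: cylinder_iff)
      then have "take n w = map X [0..<n]" by (metis (mono_tags, lifting) W_def add_0 mem_Collect_eq take_map take_upt)
      then show "X \<in> ?F" using w by (simp add: W_def)
    qed
    have EFC: "E \<inter> ?F \<subseteq> ?C"
    proof
      fix X assume X: "X \<in> E \<inter> ?F"
      define m where "m = (LEAST m. n \<le> m \<and> R (map X [0..<m]))"
      have "\<exists>m. n \<le> m \<and> R (map X [0..<m])" using inf[of X n] X by blast
      then have m: "n \<le> m \<and> R (map X [0..<m])" unfolding m_def by (rule LeastI_ex)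
      have "\<not> R (map X [0..<k])" if "n \<le> k" "k < m" for k
        using not_less_Least[of k "\<lambda>m. n \<le> m \<and> R (map X [0..<m])"] that by (auto simp: m_def)
      then have "map X [0..<m] \<in> W" using X m by (auto simp: W_def take_map)
      then show "X \<in> ?C" using cylinder_prefix by blast
    qed
    have "\<delta> * measure M E \<le> \<delta> * (measure M ?C + measure M (E - ?F))"
    proof -
      have "measure M E \<le> measure M (?C \<union> (E - ?F))"
        using EFC E C F by (intro finite_measure_mono sets.Un sets.Diff) auto
      also have "\<dots> \<le> measure M ?C + measure M (E - ?F)"
        using E C F by (intro measure_Un_le sets.Diff)
      finally show ?thesis using \<open>\<delta> > 0\<close> by simp
    qed
    moreover have "measure M (E - ?F) \<le> e"
    proof -
      have "measure M (E - ?F) \<le> measure M ((E - ?F) \<union> (?F - E))"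
        using E F by (intro finite_measure_mono sets.Un sets.Diff) auto
      then show ?thesis using nS by simp
    qed
    moreover have "\<delta> * measure M ?C \<le> e"
    proof -
      have "ennreal \<delta> * emeasure M ?C = (\<integral>\<^sup>+w. ennreal \<delta> * emeasure M (cylinder w) \<partial>count_space W)"
        using disj by (simp add: emeasure_UN_countable nn_integral_cmult)
      also have "\<dots> \<le> (\<integral>\<^sup>+w. emeasure M (cylinder w - E) \<partial>count_space W)"
      proof (rule nn_integral_mono)
        fix w assume "w \<in> space (count_space W)"
        then have "R w" by (simp add: W_def)
        then show "ennreal \<delta> * emeasure M (cylinder w) \<le> emeasure M (cylinder w - E)"
          using exit[of w] \<open>\<delta> > 0\<close> by (simp add: emeasure_eq_measure flip: ennreal_mult')
      qed
      also have "\<dots> = emeasure M (\<Union>w\<in>W. cylinder w - E)"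
        using disj E by (intro emeasure_UN_countable[symmetric]) (auto simp: disjoint_family_on_def)
      also have "\<dots> \<le> emeasure M ((E - ?F) \<union> (?F - E))"
        using CF E F by (intro emeasure_mono sets.Un sets.Diff) auto
      finally have "\<delta> * measure M ?C \<le> measure M ((E - ?F) \<union> (?F - E))"
        using \<open>\<delta> > 0\<close> by (simp add: emeasure_eq_measure flip: ennreal_mult')
      then show ?thesis using nS by simp
    qed
    moreover have "\<delta> * measure M (E - ?F) \<le> \<delta> * e" using calculation(2) \<open>\<delta> > 0\<close> by simp
    ultimately show ?thesis by (simp add: algebra_simps)
  qed
  show ?thesis
  proof (rule ccontr)
    assume "measure M E \<noteq> 0"
    then have pos: "measure M E > 0" by (simp add: zero_less_measure_iff)
    \<comment> \<open>With this choice \<open>e * (\<delta> + 1)\<close> is half of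
      \<open>\<delta> * measure M E\<close>, whereas \<open>bound\<close> makes it at least the
      whole.\<close>
    define e where "e = \<delta> * measure M E / (2 * (\<delta> + 1))"
    have "e > 0" using pos \<open>\<delta> > 0\<close> by (simp add: e_def)
    have "e * (\<delta> + 1) = \<delta> * measure M E / 2" using \<open>\<delta> > 0\<close> by (simp add: e_def field_simps)
    moreover have "\<delta> * measure M E \<le> e * (\<delta> + 1)"
      using bound[OF \<open>e > 0\<close>] by (simp add: algebra_simps)
    moreover have "\<delta> * measure M E > 0" using pos \<open>\<delta> > 0\<close> by simp
    ultimately show False by linarith
  qed
qed

subsection \<open>The quenched walk\<close>

text \<open>The product of the transition probabilities along the path \<open>x # w\<close>. Keeping
  the start outside the list makes it multiplicative under concatenation.\<close>

fun path_weight :: "('d::finite) env \<Rightarrow> int ^ 'd \<Rightarrow> (int ^ 'd) list \<Rightarrow> ennreal" where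
  "path_weight \<omega> x [] = 1"
| "path_weight \<omega> x (y # w) =
     (if y - x \<in> unit_vecs then ennreal (\<omega> x (y - x)) else 0) * path_weight \<omega> y w"

lemma path_weight_append:
  "path_weight \<omega> x (u @ v) = path_weight \<omega> x u * path_weight \<omega> (last (x # u)) v"
  by (induction u arbitrary: x) (auto simp: mult.assoc)

text \<open>The environment at the final site has not been consulted yet, hence
  \<open>butlast\<close>. This is why a prefix ending at a strict record carries no information
  about the environment at the record itself.\<close>

lemma path_weight_cong:
  assumes "\<And>z. z \<in> set (butlast (x # w)) \<Longrightarrow> \<omega> z = \<omega>' z"
  shows "path_weight \<omega> x w = path_weight \<omega>' x w"
  using assms
proof (induction w arbitrary: x)
  case (Cons y w)
  then have "\<omega> x = \<omega>' x" "path_weight \<omega> y w = path_weight \<omega>' y w" by auto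
  then show ?case by simp
qed simp

lemma path_weight_translate:
  "path_weight (\<lambda>z. \<omega> (z + v)) x w = path_weight \<omega> (x + v) (map (\<lambda>z. z + v) w)"
  by (induction w arbitrary: x) auto

lemma space_quenched:
  assumes "\<And>z. \<omega> z \<in> prob_vectors"
  shows "space (quenched \<omega> x) = UNIV"
  using sets_eq_imp_space_eq[OF sets_quenched[OF assms]] by simp

lemma quenched_cylinder_Cons:
  assumes \<omega>: "\<And>z. \<omega> z \<in> prob_vectors"
  shows "emeasure (quenched \<omega> x) (cylinder (y # w)) = (if y = x then path_weight \<omega> x w else 0)"
proof -
  have "cylinder (y # w) = {X. \<forall>i\<le>length w. X i = (y # w) ! i}"
    by (simp add: cylinder_def less_Suc_eq_le)
  moreover have "(\<Prod>i<length w. if (y # w) ! (Suc i) - (y # w) ! i \<in> unit_vecs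
      then ennreal (\<omega> ((y # w) ! i) ((y # w) ! (Suc i) - (y # w) ! i)) else 0) = path_weight \<omega> y w"
  proof (induction w arbitrary: y)
    case (Cons z w)
    show ?case
      by (simp only: length_Cons prod.lessThan_Suc_shift nth_Cons_Suc nth_Cons_0 path_weight.simps Cons.IH[symmetric])
  qed simp
  ultimately show ?thesis using quenched_cylinder[of \<omega>, OF \<omega>, of x "length w" "\<lambda>i. (y # w) ! i"] by auto
qed

lemma measurable_shift: "(\<lambda>X k. X (m + k)) \<in> measurable seq_space seq_space"
  by (intro measurable_PiM_single') (auto intro: measurable_component_singleton)

text \<open>As functions of \<open>A\<close> both sides are measures, and on cylinders they agree
  because \<open>path_weight\<close> is multiplicative. The shift is by \<open>length w\<close>, one
  less than the length of \<open>y # w\<close>, so the restarted path begins at the last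
  letter.\<close>

lemma quenched_markov:
  fixes \<omega> :: "('d::finite) env"
  assumes \<omega>: "\<And>z. \<omega> z \<in> prob_vectors" and A: "A \<in> sets path_space"
  shows "emeasure (quenched \<omega> x) (cylinder (y # w) \<inter> (\<lambda>X k. X (length w + k)) -` A) =
    emeasure (quenched \<omega> x) (cylinder (y # w)) * emeasure (quenched \<omega> (last (y # w))) A"
proof -
  let ?Q = "quenched \<omega> x" and ?s = "\<lambda>X k. X (length w + k) :: int ^ 'd" and ?c = "cylinder (y # w)"
  interpret prob_space ?Q using \<omega> by (rule prob_space_quenched)
  have sQ[measurable_cong]: "sets (quenched \<omega> z) = sets path_space" for z
    using \<omega> by (rule sets_quenched)
  have c[measurable]: "?c \<in> sets ?Q" by (simp add: sQ)
  let ?M = "distr (density ?Q (indicator ?c)) path_space ?s"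
  let ?N = "density (quenched \<omega> (last (y # w))) (\<lambda>_. emeasure ?Q ?c)"
  have M: "emeasure ?M B = emeasure ?Q (?c \<inter> ?s -` B)" if B[measurable]: "B \<in> sets path_space" for B
  proof -
    have "?s -` B \<in> sets ?Q"
      using measurable_sets[OF measurable_shift B, of "length w"] by (simp add: sQ space_quenched[of \<omega>, OF \<omega>])
    moreover have "?s \<in> measurable ?Q path_space"
      unfolding measurable_cong_sets[OF sQ refl] by (rule measurable_shift)
    ultimately show ?thesis using B
      by (subst emeasure_distr)
        (simp_all add: emeasure_density space_quenched[of \<omega>, OF \<omega>] flip: indicator_inter_arith)
  qed
  have N: "emeasure ?N B = emeasure ?Q ?c * emeasure (quenched \<omega> (last (y # w))) B"
    if "B \<in> sets path_space" for B
    using that by (simp add: emeasure_density nn_integral_cmult sQ)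
  have "?M = ?N"
  proof (rule measure_eqI_cylinder)
    show "finite_measure ?M"
      by (rule finite_measureI) (use M[of UNIV] sets.top[of "path_space :: (nat \<Rightarrow> int ^ 'd) measure"] in simp)
    fix v :: "(int ^ 'd) list"
    show "emeasure ?M (cylinder v) = emeasure ?N (cylinder v)"
    proof (cases v)
      case Nil
      interpret q: prob_space "quenched \<omega> z" for z using \<omega> by (rule prob_space_quenched)
      show ?thesis
        using q.emeasure_space_1 M[OF cylinder_sets, of v] N[OF cylinder_sets, of v]
        by (simp add: Nil space_quenched[of \<omega>, OF \<omega>])
    next
      case (Cons z u)
      \<comment> \<open>The two words overlap in one letter: \<open>z\<close> must equal
        \<open>last (y # w)\<close> and occurs only once in the glued word.\<close>
      have "?c \<inter> ?s -` cylinder v = (if z = last (y # w) then cylinder (y # w @ u) else {})"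
      proof -
        have "X \<in> ?c \<inter> ?s -` cylinder v \<longleftrightarrow> z = last (y # w) \<and> X \<in> cylinder (y # w @ u)" for X
        proof -
          have "X (length w) = last (y # w)" if "X \<in> ?c"
            using that by (auto simp: cylinder_def last_conv_nth)
          moreover have "?s X \<in> cylinder v \<longleftrightarrow> X (length w) = z \<and> (\<lambda>k. X (length (y # w) + k)) \<in> cylinder u"
            using cylinder_append[of "?s X" "[z]" u] unfolding Cons by (simp add: cylinder_def[of "[z]"])
          moreover have "X \<in> cylinder (y # w @ u) \<longleftrightarrow> X \<in> ?c \<and> (\<lambda>k. X (length (y # w) + k)) \<in> cylinder u"
            using cylinder_append[of X "y # w" u] by simp
          ultimately show ?thesis by (simp only: Int_iff vimage_eq) metis
        qed
        then show ?thesis by (simp add: set_eq_iff del: Int_iff vimage_eq)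
      qed
      then show ?thesis
        using M[OF cylinder_sets, of v] N[OF cylinder_sets, of v]
        by (auto simp: Cons quenched_cylinder_Cons[of \<omega>, OF \<omega>] path_weight_append)
    qed
  qed (auto simp: sQ)
  then show ?thesis using M[OF A] N[OF A] by simp
qed

lemma quenched_translate:
  fixes \<omega> :: "('d::finite) env"
  assumes \<omega>: "\<And>z. \<omega> z \<in> prob_vectors" and A: "A \<in> sets path_space"
  shows "emeasure (quenched \<omega> (x + v)) A =
    emeasure (quenched (\<lambda>z. \<omega> (z + v)) x) ((\<lambda>X n. X n + v) -` A)"
proof -
  let ?t = "\<lambda>X n. X n + v :: int ^ 'd" and ?Q = "quenched (\<lambda>z. \<omega> (z + v)) x"
  have \<omega>': "\<And>z. \<omega> (z + v) \<in> prob_vectors" using \<omega> .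
  have sQ: "sets ?Q = sets path_space" using sets_quenched[of "\<lambda>z. \<omega> (z + v)", OF \<omega>'] .
  have t: "?t \<in> measurable ?Q path_space"
    unfolding measurable_cong_sets[OF sQ refl] by (intro measurable_PiM_single') auto
  have M: "emeasure (distr ?Q path_space ?t) B = emeasure ?Q (?t -` B)" if "B \<in> sets path_space" for B
    using emeasure_distr[OF t that] space_quenched[of "\<lambda>z. \<omega> (z + v)", OF \<omega>'] by simp
  have "distr ?Q path_space ?t = quenched \<omega> (x + v)"
  proof (rule measure_eqI_cylinder)
    show "finite_measure (distr ?Q path_space ?t)"
      using prob_space.prob_space_distr[OF prob_space_quenched[of "\<lambda>z. \<omega> (z + v)", OF \<omega>'] t]
      by (simp add: prob_space_def)
    fix w :: "(int ^ 'd) list"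
    show "emeasure (distr ?Q path_space ?t) (cylinder w) = emeasure (quenched \<omega> (x + v)) (cylinder w)"
    proof (cases w)
      case Nil
      then show ?thesis
        using M[OF cylinder_sets, of w] prob_space.emeasure_space_1[OF prob_space_quenched[of \<omega>, OF \<omega>]]
          prob_space.emeasure_space_1[OF prob_space_quenched[of "\<lambda>z. \<omega> (z + v)", OF \<omega>']]
        by (simp add: space_quenched[of \<omega>, OF \<omega>] space_quenched[of "\<lambda>z. \<omega> (z + v)", OF \<omega>'])
    next
      case (Cons y u)
      have "?t -` cylinder w = cylinder (map (\<lambda>z. z - v) w)"
        unfolding cylinder_def vimage_def by (simp add: eq_diff_eq)
      then show ?thesis
        using M[OF cylinder_sets, of w]
        by (auto simp: Cons quenched_cylinder_Cons[of \<omega>, OF \<omega>] quenched_cylinder_Cons[of "\<lambda>z. \<omega> (z + v)", OF \<omega>'] path_weight_translate o_def)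
    qed
  qed (simp_all add: sets_quenched[of \<omega>, OF \<omega>])
  then show ?thesis using M[OF A] by simp
qed

text \<open>A path that remains in \<open>H\<close> only uses transition probabilities at sites of
  \<open>H\<close>. So both laws, restricted to such paths, agree on cylinders and therefore
  everywhere.\<close>

lemma quenched_local:
  fixes \<omega> :: "('d::finite) env"
  assumes \<omega>: "\<And>z. \<omega> z \<in> prob_vectors" and \<omega>': "\<And>z. \<omega>' z \<in> prob_vectors"
    and eq: "\<And>z. z \<in> H \<Longrightarrow> \<omega> z = \<omega>' z"
    and A: "A \<in> sets path_space" "A \<subseteq> {X. range X \<subseteq> H}"
  shows "emeasure (quenched \<omega> x) A = emeasure (quenched \<omega>' x) A"
proof -
  let ?D = "{X :: nat \<Rightarrow> int ^ 'd. range X \<subseteq> H}"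
  have D: "?D \<in> sets path_space"
  proof -
    have "?D = {X \<in> space path_space. \<forall>i. X i \<in> H}" by auto
    also have "\<dots> \<in> sets path_space" by measurable
    finally show ?thesis .
  qed
  have dens: "emeasure (density (quenched \<omega> x) (indicator ?D)) B = emeasure (quenched \<omega> x) (B \<inter> ?D)"
    if "\<And>z. \<omega> z \<in> prob_vectors" "B \<in> sets path_space" for B and \<omega> :: "'d env"
  proof -
    have "?D \<in> sets (quenched \<omega> x)" "B \<in> sets (quenched \<omega> x)"
      using that(2) D sets_quenched[of \<omega>, OF that(1)] by simp_all
    then show ?thesis
      by (subst emeasure_density) (simp_all add: Int_commute flip: indicator_inter_arith)
  qed
  \<comment> \<open>Staying in \<open>H\<close> forever is the decreasing limit of staying in
    \<open>H\<close> up to time \<open>length w + m\<close>, and each of these events is a countable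
    disjoint union of cylinders over words in \<open>H\<close>. The \<open>Suc\<close> keeps these
    words nonempty even for empty \<open>w\<close>.\<close>
  have cyl: "emeasure (quenched \<omega> x) (cylinder w \<inter> ?D) =
      (INF m. \<integral>\<^sup>+v. emeasure (quenched \<omega> x) (cylinder v) \<partial>count_space {v. length v = Suc (length w + m) \<and> set v \<subseteq> H \<and> take (length w) v = w})"
    if "\<And>z. \<omega> z \<in> prob_vectors" for w and \<omega> :: "'d env"
  proof -
    interpret prob_space "quenched \<omega> x" using that by (rule prob_space_quenched)
    let ?V = "\<lambda>m. {v. length v = Suc (length w + m) \<and> set v \<subseteq> H \<and> take (length w) v = w}"
    define C where "C m = (\<Union>v\<in>?V m. cylinder v)" for m
    have C: "X \<in> C m \<longleftrightarrow> X \<in> cylinder w \<and> X ` {..length w + m} \<subseteq> H" for X m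
    proof -
      have "X \<in> C m \<longleftrightarrow> map X [0..<Suc (length w + m)] \<in> ?V m"
        unfolding C_def UN_iff cylinder_iff by (metis (mono_tags, lifting) diff_zero length_map length_upt mem_Collect_eq)
      also have "\<dots> \<longleftrightarrow> X \<in> cylinder w \<and> X ` {..length w + m} \<subseteq> H"
        by (auto simp: cylinder_iff take_map simp del: upt_Suc)
      finally show ?thesis .
    qed
    have "(\<Inter>m. C m) = cylinder w \<inter> ?D"
    proof (intro equalityI subsetI)
      fix X assume X: "X \<in> (\<Inter>m. C m)"
      then have "X i \<in> H" for i using C[of X i] by auto
      then show "X \<in> cylinder w \<inter> ?D" using X C[of X 0] by auto
    qed (auto simp: C)
    moreover have "(INF m. emeasure (quenched \<omega> x) (C m)) = emeasure (quenched \<omega> x) (\<Inter>m. C m)"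
    proof (rule INF_emeasure_decseq)
      show "range C \<subseteq> sets (quenched \<omega> x)"
        by (auto simp: C_def sets_quenched[of \<omega>, OF that])
      show "decseq C" unfolding decseq_def by (force simp: C)
    qed simp
    moreover have "emeasure (quenched \<omega> x) (C m) = (\<integral>\<^sup>+v. emeasure (quenched \<omega> x) (cylinder v) \<partial>count_space (?V m))" for m
      unfolding C_def
    proof (rule emeasure_UN_countable)
      show "disjoint_family_on cylinder (?V m)"
        unfolding disjoint_family_on_def by auto (metis cylinder_iff)
    qed (auto simp: sets_quenched[of \<omega>, OF that])
    ultimately show ?thesis by simp
  qed
  have w: "emeasure (quenched \<omega> x) (cylinder v) = emeasure (quenched \<omega>' x) (cylinder v)"
    if "set v \<subseteq> H" "v \<noteq> []" for v
  proof (cases v)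
    case (Cons y u)
    have "path_weight \<omega> y u = path_weight \<omega>' y u"
      using that eq in_set_butlastD[of _ "y # u"] unfolding Cons by (intro path_weight_cong) blast
    then show ?thesis by (auto simp: Cons quenched_cylinder_Cons[of \<omega>, OF \<omega>] quenched_cylinder_Cons[of \<omega>', OF \<omega>'])
  qed (use that in simp)
  have "density (quenched \<omega> x) (indicator ?D) = density (quenched \<omega>' x) (indicator ?D)"
  proof (rule measure_eqI_cylinder)
    show "finite_measure (density (quenched \<omega> x) (indicator ?D))"
      using prob_space.emeasure_le_1[OF prob_space_quenched[of \<omega>, OF \<omega>], of x "UNIV \<inter> ?D"]
        dens[of \<omega>, OF \<omega>, of UNIV] sets.top[of "path_space :: (nat \<Rightarrow> int ^ 'd) measure"]
      by (intro finite_measureI) (auto simp: space_quenched[of \<omega>, OF \<omega>] top_unique)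
    fix v :: "(int ^ 'd) list"
    show "emeasure (density (quenched \<omega> x) (indicator ?D)) (cylinder v) =
        emeasure (density (quenched \<omega>' x) (indicator ?D)) (cylinder v)"
      unfolding dens[of \<omega>, OF \<omega> cylinder_sets] dens[of \<omega>', OF \<omega>' cylinder_sets] cyl[of \<omega>, OF \<omega>] cyl[of \<omega>', OF \<omega>']
      by (intro INF_cong nn_integral_cong w refl) auto
  qed (simp_all add: sets_quenched \<omega> \<omega>')
  then have "emeasure (quenched \<omega> x) (A \<inter> ?D) = emeasure (quenched \<omega>' x) (A \<inter> ?D)"
    using dens[of \<omega>, OF \<omega> A(1)] dens[of \<omega>', OF \<omega>' A(1)] by simp
  then show ?thesis using A(2) by (simp add: Int_absorb2)
qed

subsection \<open>Functions of disjoint sets of coordinates\<close>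

text \<open>Dependence on a block of coordinates is expressed through equality of values, so
  \<open>f\<close> and \<open>g\<close> need not be factored through products over the
  blocks.\<close>

lemma nn_integral_PiM_mult_disjoint:
  fixes f g :: "('i \<Rightarrow> 'b) \<Rightarrow> ennreal" and M :: "'b measure"
  defines "P \<equiv> PiM UNIV (\<lambda>_. M)"
  assumes M: "prob_space M" and f: "f \<in> borel_measurable P" and g: "g \<in> borel_measurable P"
    and fA: "\<And>\<omega> \<omega>'. \<omega> \<in> space P \<Longrightarrow> \<omega>' \<in> space P \<Longrightarrow> (\<And>i. i \<in> A \<Longrightarrow> \<omega> i = \<omega>' i) \<Longrightarrow> f \<omega> = f \<omega>'"
    and gA: "\<And>\<omega> \<omega>'. \<omega> \<in> space P \<Longrightarrow> \<omega>' \<in> space P \<Longrightarrow> (\<And>i. i \<notin> A \<Longrightarrow> \<omega> i = \<omega>' i) \<Longrightarrow> g \<omega> = g \<omega>'"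
  shows "(\<integral>\<^sup>+\<omega>. f \<omega> * g \<omega> \<partial>P) = (\<integral>\<^sup>+\<omega>. f \<omega> \<partial>P) * (\<integral>\<^sup>+\<omega>. g \<omega> \<partial>P)"
proof -
  interpret M: prob_space M by fact
  interpret product_prob_space "\<lambda>_. M" "UNIV :: 'i set" by unfold_locales
  interpret Q: prob_space P unfolding P_def by unfold_locales
  \<comment> \<open>Gluing two independent samples along \<open>A\<close> gives a sample of the same law.\<close>
  define T where "T p = (\<lambda>i. if i \<in> A then fst p i else snd p i)" for p :: "('i \<Rightarrow> 'b) \<times> ('i \<Rightarrow> 'b)"
  have comp: "(\<lambda>\<omega>. \<omega> i) \<in> measurable P M" for i
    unfolding P_def by (rule measurable_component_singleton) simp
  have T[measurable]: "T \<in> measurable (P \<Otimes>\<^sub>M P) P"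
    unfolding P_def T_def
  proof (rule measurable_PiM_single')
    fix i
    show "(\<lambda>p. if i \<in> A then fst p i else snd p i) \<in> measurable (PiM UNIV (\<lambda>_. M) \<Otimes>\<^sub>M PiM UNIV (\<lambda>_. M)) M"
      using measurable_compose[OF measurable_fst comp[of i]] measurable_compose[OF measurable_snd comp[of i]]
      by (cases "i \<in> A") (simp_all add: P_def)
  qed (auto simp: space_pair_measure space_PiM PiE_iff)
  have "distr (P \<Otimes>\<^sub>M P) P T = P"
    unfolding P_def
  proof (rule PiM_eq)
    fix J and F :: "'i \<Rightarrow> 'b set" assume J: "finite J" and F: "\<And>j. j \<in> J \<Longrightarrow> F j \<in> sets M"
    let ?e = "\<lambda>J. prod_emb UNIV (\<lambda>_. M) J (PiE J F)"
    have e: "?e J' \<in> sets P" if "J' \<subseteq> J" for J'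
      using that J F finite_subset unfolding P_def by (intro sets_PiM_I) auto
    have "T -` ?e J \<inter> space (P \<Otimes>\<^sub>M P) = ?e (J \<inter> A) \<times> ?e (J - A)"
      by (auto simp: T_def P_def space_pair_measure space_PiM prod_emb_def PiE_iff split: if_splits)
    then have "emeasure (distr (P \<Otimes>\<^sub>M P) P T) (?e J) = emeasure P (?e (J \<inter> A)) * emeasure P (?e (J - A))"
      using e[of J] e[of "J \<inter> A"] e[of "J - A"]
      by (subst emeasure_distr) (auto simp: Q.emeasure_pair_measure_Times)
    also have "\<dots> = (\<Prod>j\<in>J \<inter> A. emeasure M (F j)) * (\<Prod>j\<in>J - A. emeasure M (F j))"
      using J F unfolding P_def by (subst (1 2) emeasure_PiM_emb) auto
    also have "\<dots> = (\<Prod>j\<in>J. emeasure M (F j))"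
      using J by (subst prod.Int_Diff[of J _ A]) auto
    finally show "emeasure (distr (PiM UNIV (\<lambda>_. M) \<Otimes>\<^sub>M PiM UNIV (\<lambda>_. M)) (PiM UNIV (\<lambda>_. M)) T)
        (prod_emb UNIV (\<lambda>_. M) J (PiE J F)) = (\<Prod>j\<in>J. emeasure M (F j))"
      by (simp add: P_def)
  qed simp
  then have "(\<integral>\<^sup>+\<omega>. f \<omega> * g \<omega> \<partial>P) = (\<integral>\<^sup>+\<omega>. f \<omega> * g \<omega> \<partial>distr (P \<Otimes>\<^sub>M P) P T)" by simp
  also have "\<dots> = (\<integral>\<^sup>+p. f (T p) * g (T p) \<partial>(P \<Otimes>\<^sub>M P))"
    using f g by (intro nn_integral_distr) auto
  also have "\<dots> = (\<integral>\<^sup>+p. f (fst p) * g (snd p) \<partial>(P \<Otimes>\<^sub>M P))"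
  proof (rule nn_integral_cong)
    fix p assume p: "p \<in> space (P \<Otimes>\<^sub>M P)"
    then have "T p \<in> space P" "fst p \<in> space P" "snd p \<in> space P"
      using measurable_space[OF T] by (auto simp: space_pair_measure)
    then have "f (T p) = f (fst p)" "g (T p) = g (snd p)"
      by (auto intro!: fA gA simp: T_def)
    then show "f (T p) * g (T p) = f (fst p) * g (snd p)" by simp
  qed
  also have "\<dots> = (\<integral>\<^sup>+\<omega>. \<integral>\<^sup>+\<omega>'. f \<omega> * g \<omega>' \<partial>P \<partial>P)"
    using f g by (subst Q.nn_integral_fst[symmetric]) auto
  also have "\<dots> = (\<integral>\<^sup>+\<omega>. f \<omega> \<partial>P) * (\<integral>\<^sup>+\<omega>. g \<omega> \<partial>P)"
    using f g by (simp add: nn_integral_cmult nn_integral_multc)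
  finally show ?thesis .
qed

subsection \<open>Escaping paths\<close>

lemma real_vec_add: "real_vec (x + y) = real_vec x + real_vec y"
  by (simp add: real_vec_def vec_eq_iff)

lemma real_vec_0 [simp]: "real_vec 0 = 0"
  by (simp add: real_vec_def vec_eq_iff)

lemma finite_real_vec_ball: "finite {z :: int ^ 'd. norm (real_vec z) \<le> K}"
proof -
  have "{z :: int ^ 'd. norm (real_vec z) \<le> K} \<subseteq> vec_lambda ` (UNIV \<rightarrow>\<^sub>E {- \<lceil>K\<rceil>..\<lceil>K\<rceil>})"
  proof
    fix z :: "int ^ 'd" assume z: "z \<in> {z. norm (real_vec z) \<le> K}"
    have "z $ i \<in> {- \<lceil>K\<rceil>..\<lceil>K\<rceil>}" for i
    proof -
      have "\<bar>real_vec z $ i\<bar> \<le> norm (real_vec z)" by (rule component_le_norm_cart)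
      then have "\<bar>real_of_int (z $ i)\<bar> \<le> K" using z by (simp add: real_vec_def)
      then show ?thesis by (simp add: abs_le_iff) linarith
    qed
    then have "vec_nth z \<in> UNIV \<rightarrow>\<^sub>E {- \<lceil>K\<rceil>..\<lceil>K\<rceil>}" by auto
    then show "z \<in> vec_lambda ` (UNIV \<rightarrow>\<^sub>E {- \<lceil>K\<rceil>..\<lceil>K\<rceil>})" by (metis image_eqI vec_nth_inverse)
  qed
  then show ?thesis
    by (rule finite_subset) (intro finite_imageI finite_PiE; simp)
qed

lemma frequently_translates:
  fixes X :: "nat \<Rightarrow> int ^ 'd"
  assumes "\<exists>\<^sub>F n in sequentially. X n = z"
    and "\<And>z. \<exists>\<^sub>F n in sequentially. X n = z \<Longrightarrow> \<exists>\<^sub>F n in sequentially. X n = z + e"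
  shows "\<exists>y. real_vec y = real_vec z + real k *\<^sub>R real_vec e \<and> (\<exists>\<^sub>F n in sequentially. X n = y)"
proof (induction k)
  case 0
  then show ?case using assms(1) by auto
next
  case (Suc k)
  then obtain y where "real_vec y = real_vec z + real k *\<^sub>R real_vec e" "\<exists>\<^sub>F n in sequentially. X n = y"
    by blast
  then show ?case
    using assms(2)[of y] by (intro exI[of _ "y + e"]) (simp add: real_vec_add algebra_simps)
qed

text \<open>A site visited infinitely often must itself have direction \<open>\<nu>\<close>, hence a
  nonnegative inner product with \<open>\<nu>\<close>. By \<open>closed\<close>, one such site would
  yield a whole ray of them, along which this product tends to minus infinity. So every site, and
  hence every bounded set, is eventually left.\<close>

lemma norm_tendsto_infinity_of_direction:
  fixes X :: "nat \<Rightarrow> int ^ 'd"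
  assumes closed: "\<And>z e. e \<in> unit_vecs \<Longrightarrow> \<exists>\<^sub>F n in sequentially. X n = z \<Longrightarrow>
      \<exists>\<^sub>F n in sequentially. X n = z + e"
    and lim: "(\<lambda>n. sgn (real_vec (X n))) \<longlonglongrightarrow> \<nu>" and "norm \<nu> = 1"
  shows "filterlim (\<lambda>n. norm (real_vec (X n))) at_top sequentially"
proof -
  have "\<forall>\<^sub>F n in sequentially. X n \<noteq> z" for z
  proof (rule ccontr)
    assume "\<not> (\<forall>\<^sub>F n in sequentially. X n \<noteq> z)"
    then have z: "\<exists>\<^sub>F n in sequentially. X n = z" by (simp add: frequently_def)
    obtain i where i: "\<nu> $ i \<noteq> 0" using \<open>norm \<nu> = 1\<close> by (metis norm_zero vec_eq_iff zero_index zero_neq_one)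
    \<comment> \<open>The sign is opposite to that of \<open>\<nu> $ i\<close>, so that the step
      \<open>e\<close> goes against \<open>\<nu>\<close>.\<close>
    define c :: int where "c = (if \<nu> $ i > 0 then -1 else 1)"
    define e :: "int ^ 'd" where "e = axis i c"
    have "e \<in> unit_vecs" unfolding unit_vecs_eq e_def c_def by auto
    have e\<nu>: "real_vec e \<bullet> \<nu> < 0"
    proof -
      have "real_vec e = axis i (real_of_int c)" by (auto simp: e_def real_vec_def vec_eq_iff axis_def)
      then have "real_vec e \<bullet> \<nu> = real_of_int c * \<nu> $ i" by (simp add: inner_axis')
      then show ?thesis using i by (auto simp: c_def)
    qed
    have pos: "(real_vec z + real k *\<^sub>R real_vec e) \<bullet> \<nu> \<ge> 0" for k
    proof -
      obtain y where y: "real_vec y = real_vec z + real k *\<^sub>R real_vec e"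
        and yX: "\<exists>\<^sub>F n in sequentially. X n = y"
        using frequently_translates[OF z] closed[OF \<open>e \<in> unit_vecs\<close>] by blast
      from yX have "\<exists>\<^sub>F n in sequentially. sgn (real_vec (X n)) = sgn (real_vec y)"
        by (rule frequently_elim1) simp
      then have "sgn (real_vec y) = \<nu>"
        using tendsto_imp_eventually_ne[OF lim, of "sgn (real_vec y)"] by (auto simp: frequently_def)
      then have "real_vec y = norm (real_vec y) *\<^sub>R \<nu>" by (cases "real_vec y = 0") (auto simp: sgn_div_norm)
      then have "real_vec y \<bullet> \<nu> = norm (real_vec y) * (\<nu> \<bullet> \<nu>)" by (metis inner_scaleR_left)
      then show ?thesis unfolding y[symmetric] by (simp add: zero_le_mult_iff)
    qed
    obtain k where "real_vec z \<bullet> \<nu> < real k * (- (real_vec e \<bullet> \<nu>))"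
      using ex_less_of_nat_mult[of "- (real_vec e \<bullet> \<nu>)" "real_vec z \<bullet> \<nu>"] e\<nu> by auto
    then show False using pos[of k] by (simp add: inner_add_left)
  qed
  then have away: "\<forall>\<^sub>F n in sequentially. \<forall>z\<in>{z. norm (real_vec z) \<le> K}. X n \<noteq> z" for K
    by (intro eventually_ball_finite finite_real_vec_ball) blast
  have "\<forall>\<^sub>F n in sequentially. K \<le> norm (real_vec (X n))" for K
    by (rule eventually_mono[OF away[of K]]) (metis linear mem_Collect_eq)
  then show ?thesis by (simp add: filterlim_at_top)
qed

text \<open>Including divergence of the norm makes the event invariant under translations for unit
  vectors \<open>\<nu>\<close>; it also sends \<open>l \<bullet> real_vec (X n)\<close> to infinity
  whenever \<open>l \<bullet> \<nu> > 0\<close>. Since \<open>sgn 0 = 0\<close>, the convention at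
  the origin is that of \<open>limit_dir_event\<close>.\<close>

definition escape_dir :: "real ^ 'd \<Rightarrow> (nat \<Rightarrow> int ^ 'd) set" where
  "escape_dir \<nu> = {X. (\<lambda>n. sgn (real_vec (X n))) \<longlonglongrightarrow> \<nu> \<and>
     filterlim (\<lambda>n. norm (real_vec (X n))) at_top sequentially}"

lemma escape_dir_sets [simp]: "escape_dir \<nu> \<in> sets path_space"
proof -
  have comp: "(\<lambda>X. X n) \<in> measurable path_space (count_space UNIV)" for n :: nat
    by (rule measurable_component_singleton) simp
  have [measurable]: "(\<lambda>X. dist (sgn (real_vec (X n))) \<nu>) \<in> borel_measurable path_space" for n
    by (rule measurable_compose[OF comp]) simp
  have [measurable]: "(\<lambda>X. norm (real_vec (X n))) \<in> borel_measurable path_space" for n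
    by (rule measurable_compose[OF comp]) simp
  have top: "filterlim f at_top sequentially \<longleftrightarrow> (\<forall>k::nat. \<exists>N. \<forall>n\<ge>N. real k \<le> f n)" for f :: "nat \<Rightarrow> real"
    unfolding filterlim_at_top eventually_sequentially by (meson order_trans real_arch_simple)
  have "escape_dir \<nu> = {X \<in> space path_space. (\<lambda>n. dist (sgn (real_vec (X n))) \<nu>) \<longlonglongrightarrow> 0 \<and>
      (\<forall>k::nat. \<exists>N. \<forall>n\<ge>N. real k \<le> norm (real_vec (X n)))}"
    unfolding escape_dir_def top by (subst tendsto_dist_iff) auto
  also have "\<dots> \<in> sets path_space" by measurable
  finally show ?thesis .
qed

lemma escape_dir_shift: "(\<lambda>k. X (m + k)) \<in> escape_dir \<nu> \<longleftrightarrow> X \<in> escape_dir \<nu>"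
proof -
  have "filterlim (\<lambda>n. f (m + n)) F sequentially \<longleftrightarrow> filterlim f F sequentially" for f :: "nat \<Rightarrow> 'b" and F
    unfolding filterlim_iff add.commute[of m]
    using eventually_sequentially_seg[of "\<lambda>n. P (f n)" m for P] by simp
  from this[of "\<lambda>n. sgn (real_vec (X n))"] this[of "\<lambda>n. norm (real_vec (X n))"]
  show ?thesis by (simp add: escape_dir_def)
qed

text \<open>After division by the norm of \<open>X n\<close> the contribution of \<open>v\<close>
  vanishes in the limit; \<open>sgn\<close> is continuous at \<open>\<nu>\<close> and unchanged by
  positive scaling.\<close>

lemma escape_dir_translate_imp:
  assumes "X \<in> escape_dir \<nu>" "norm \<nu> = 1"
  shows "(\<lambda>n. X n + v) \<in> escape_dir \<nu>"
proof -
  let ?r = "\<lambda>n. norm (real_vec (X n))"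
  have dir: "(\<lambda>n. sgn (real_vec (X n))) \<longlonglongrightarrow> \<nu>" and r: "filterlim ?r at_top sequentially"
    using assms(1) by (auto simp: escape_dir_def)
  have "filterlim (\<lambda>n. norm (real_vec (X n + v))) at_top sequentially"
  proof (rule filterlim_at_top_mono)
    show "filterlim (\<lambda>n. - norm (real_vec v) + ?r n) at_top sequentially"
      by (rule filterlim_tendsto_add_at_top[OF tendsto_const r])
    show "\<forall>\<^sub>F n in sequentially. - norm (real_vec v) + ?r n \<le> norm (real_vec (X n + v))"
      using norm_diff_ineq[of "real_vec (X n)" "real_vec v" for n] by (simp add: real_vec_add)
  qed
  moreover have "(\<lambda>n. sgn (real_vec (X n + v))) \<longlonglongrightarrow> \<nu>"
  proof (rule Lim_transform_eventually)
    have "(\<lambda>n. inverse (?r n)) \<longlonglongrightarrow> 0"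
      by (rule tendsto_inverse_0_at_top[OF r])
    then have "(\<lambda>n. sgn (real_vec (X n)) + inverse (?r n) *\<^sub>R real_vec v) \<longlonglongrightarrow> \<nu> + 0 *\<^sub>R real_vec v"
      by (intro tendsto_intros dir)
    then have "(\<lambda>n. sgn (sgn (real_vec (X n)) + inverse (?r n) *\<^sub>R real_vec v)) \<longlonglongrightarrow> sgn \<nu>"
      using \<open>norm \<nu> = 1\<close> by (intro tendsto_sgn) auto
    then show "(\<lambda>n. sgn (sgn (real_vec (X n)) + inverse (?r n) *\<^sub>R real_vec v)) \<longlonglongrightarrow> \<nu>"
      using \<open>norm \<nu> = 1\<close> by (simp add: sgn_div_norm)
    show "\<forall>\<^sub>F n in sequentially. sgn (sgn (real_vec (X n)) + inverse (?r n) *\<^sub>R real_vec v) =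
        sgn (real_vec (X n + v))"
    proof (rule eventually_mono)
      show "\<forall>\<^sub>F n in sequentially. ?r n > 0" using r unfolding filterlim_at_top_dense by blast
      fix n assume "?r n > 0"
      moreover have "sgn (real_vec (X n)) + inverse (?r n) *\<^sub>R real_vec v = inverse (?r n) *\<^sub>R real_vec (X n + v)"
        by (simp add: sgn_div_norm real_vec_add scaleR_add_right)
      ultimately show "sgn (sgn (real_vec (X n)) + inverse (?r n) *\<^sub>R real_vec v) = sgn (real_vec (X n + v))"
        by (simp add: sgn_scaleR)
    qed
  qed
  ultimately show ?thesis by (simp add: escape_dir_def)
qed

lemma escape_dir_translate:
  assumes "norm \<nu> = 1"
  shows "(\<lambda>n. X n + v) \<in> escape_dir \<nu> \<longleftrightarrow> X \<in> escape_dir \<nu>"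
  using escape_dir_translate_imp[of X \<nu> v] escape_dir_translate_imp[of "\<lambda>n. X n + v" \<nu> "- v"] assms by auto

lemma escape_dir_inner_at_top:
  assumes "X \<in> escape_dir \<nu>" "l \<bullet> \<nu> > 0"
  shows "filterlim (\<lambda>n. l \<bullet> real_vec (X n)) at_top sequentially"
proof -
  have "filterlim (\<lambda>n. (l \<bullet> sgn (real_vec (X n))) * norm (real_vec (X n))) at_top sequentially"
    using assms unfolding escape_dir_def
    by (intro filterlim_tendsto_pos_mult_at_top[of _ "l \<bullet> \<nu>"] tendsto_intros) auto
  moreover have "(l \<bullet> sgn (real_vec x)) * norm (real_vec x) = l \<bullet> real_vec x" for x :: "int ^ 'a"
    by (cases "real_vec x = 0") (simp_all add: sgn_div_norm)
  ultimately show ?thesis by simp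
qed

section \<open>Records and minima of sequences tending to infinity\<close>

lemma strict_record_exists:
  fixes a :: "nat \<Rightarrow> real"
  assumes "filterlim a at_top sequentially"
  shows "\<exists>n\<ge>N. \<forall>j<n. a j < a n"
proof -
  \<comment> \<open>The first time at which \<open>a\<close> exceeds its maximum over
    \<open>{..N}\<close> is a strict record and comes after \<open>N\<close>.\<close>
  define K where "K = Max (a ` {..N})"
  have K: "a j \<le> K" if "j \<le> N" for j using that by (simp add: K_def)
  define n where "n = (LEAST n. a n > K)"
  have "\<exists>n. a n > K"
    using assms unfolding filterlim_at_top_dense eventually_sequentially by blast
  then have n: "a n > K" unfolding n_def by (rule LeastI_ex)
  have "a j < a n" if "j < n" for j
    using not_less_Least[of j "\<lambda>n. a n > K"] that n by (simp add: n_def)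
  then show ?thesis using n K by (metis linorder_not_less nle_le)
qed

lemma exists_global_minimum:
  fixes a :: "nat \<Rightarrow> real"
  assumes "filterlim a at_top sequentially"
  obtains m where "\<And>n. a m \<le> a n"
proof -
  obtain N where N: "\<And>n. n \<ge> N \<Longrightarrow> a 0 \<le> a n"
    using assms unfolding filterlim_at_top eventually_sequentially by blast
  obtain m where m: "m \<le> N" "\<And>n. n \<le> N \<Longrightarrow> a m \<le> a n"
    using ex_min_if_finite[of "a ` {..N}"] by force
  have "a m \<le> a n" for n
    using m(2)[of n] m(2)[of 0] N[of n] by (cases "n \<le> N") auto
  then show thesis by (rule that)
qed

subsection \<open>Transience of walks with an asymptotic direction\<close>

text \<open>Every visit to \<open>z\<close> is followed by the step \<open>e\<close> with
  conditional probability \<open>\<omega> z e\<close>. By \<open>prefix_zero_law\<close>, visiting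
  \<open>z\<close> infinitely often while avoiding \<open>z + e\<close> from time \<open>N\<close>
  on has probability 0.\<close>

lemma AE_quenched_leave:
  fixes \<omega> :: "('d::finite) env"
  assumes \<omega>: "\<And>z. \<omega> z \<in> prob_vectors" and e: "e \<in> unit_vecs" and pos: "\<omega> z e > 0"
  shows "AE X in quenched \<omega> x. (\<exists>\<^sub>F n in sequentially. X n = z) \<longrightarrow> (\<exists>\<^sub>F n in sequentially. X n = z + e)"
proof -
  interpret prob_space "quenched \<omega> x" using \<omega> by (rule prob_space_quenched)
  have sQ: "sets (quenched \<omega> x) = sets path_space" using \<omega> by (rule sets_quenched)
  define E where "E N = {X :: nat \<Rightarrow> int ^ 'd. (\<forall>m. \<exists>n\<ge>m. X n = z) \<and> (\<forall>n\<ge>N. X n \<noteq> z + e)}" for N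
  have E: "E N \<in> sets (quenched \<omega> x)" for N
  proof -
    have "E N = {X \<in> space path_space. (\<forall>m. \<exists>n\<ge>m. X n = z) \<and> (\<forall>n\<ge>N. X n \<noteq> z + e)}"
      by (simp add: E_def)
    also have "\<dots> \<in> sets path_space" by measurable
    finally show ?thesis using sQ by simp
  qed
  \<comment> \<open>The step after a prefix \<open>w\<close> lands at time \<open>length w\<close>;
    requiring \<open>N \<le> length w\<close> makes a visit to \<open>z + e\<close> at that time
    violate \<open>E N\<close>.\<close>
  have "measure (quenched \<omega> x) (E N) = 0" for N
  proof (rule prefix_zero_law[OF _ sQ E pos, where R = "\<lambda>w. w \<noteq> [] \<and> last w = z \<and> N \<le> length w"])
    show "finite_measure (quenched \<omega> x)" by unfold_locales
    fix X m assume "X \<in> E N"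
    then obtain n where "n \<ge> max m N" "X n = z" unfolding E_def by blast
    then show "\<exists>n\<ge>m. map X [0..<n] \<noteq> [] \<and> last (map X [0..<n]) = z \<and> N \<le> length (map X [0..<n])"
      by (intro exI[of _ "Suc n"]) auto
  next
    fix w assume w: "w \<noteq> [] \<and> last w = z \<and> N \<le> length w"
    then obtain y u where yu: "w = y # u" by (meson neq_Nil_conv)
    have "cylinder (w @ [z + e]) \<subseteq> cylinder w - E N"
    proof
      fix X assume X: "X \<in> cylinder (w @ [z + e])"
      then have "X (length w) = z + e" by (auto simp: cylinder_def dest: spec[of _ "length w"])
      then have "X \<notin> E N" using w unfolding E_def by auto
      then show "X \<in> cylinder w - E N" using X by (simp add: cylinder_append)
    qed
    then have "measure (quenched \<omega> x) (cylinder (w @ [z + e])) \<le> measure (quenched \<omega> x) (cylinder w - E N)"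
      using E sQ by (intro finite_measure_mono) auto
    moreover have "emeasure (quenched \<omega> x) (cylinder (w @ [z + e])) =
        ennreal (\<omega> z e) * emeasure (quenched \<omega> x) (cylinder w)"
    proof -
      have "emeasure (quenched \<omega> x) (cylinder (y # u @ [z + e])) =
          ennreal (\<omega> z e) * emeasure (quenched \<omega> x) (cylinder (y # u))"
        using w e unfolding yu quenched_cylinder_Cons[of \<omega>, OF \<omega>] path_weight_append
        by (auto simp: mult.commute)
      then show ?thesis by (simp add: yu)
    qed
    ultimately show "\<omega> z e * measure (quenched \<omega> x) (cylinder w) \<le> measure (quenched \<omega> x) (cylinder w - E N)"
      using pos by (simp add: emeasure_eq_measure flip: ennreal_mult')
  qed
  then have "AE X in quenched \<omega> x. X \<notin> E N" for N
    using E by (intro AE_not_in) (simp add: null_sets_def emeasure_eq_measure)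
  then have "AE X in quenched \<omega> x. \<forall>N. X \<notin> E N" by (simp add: AE_all_countable)
  then show ?thesis
    by eventually_elim (auto simp: E_def frequently_sequentially)
qed

lemma AE_quenched_direction_imp_escape:
  fixes \<omega> :: "('d::finite) env"
  assumes \<omega>: "\<And>z. \<omega> z \<in> prob_vectors" and pos: "\<And>z e. e \<in> unit_vecs \<Longrightarrow> \<omega> z e > 0" and \<nu>: "norm \<nu> = 1"
  shows "AE X in quenched \<omega> x. (\<lambda>n. sgn (real_vec (X n))) \<longlonglongrightarrow> \<nu> \<longrightarrow> X \<in> escape_dir \<nu>"
proof -
  have "AE X in quenched \<omega> x. \<forall>z. \<forall>e. e \<in> unit_vecs \<longrightarrow>
      (\<exists>\<^sub>F n in sequentially. X n = z) \<longrightarrow> (\<exists>\<^sub>F n in sequentially. X n = z + e)"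
    unfolding AE_all_countable
  proof (intro allI)
    fix z e
    show "AE X in quenched \<omega> x. e \<in> unit_vecs \<longrightarrow>
        (\<exists>\<^sub>F n in sequentially. X n = z) \<longrightarrow> (\<exists>\<^sub>F n in sequentially. X n = z + e)"
      using AE_quenched_leave[of \<omega> e z x, OF \<omega>] pos[of e z] by (cases "e \<in> unit_vecs") auto
  qed
  then show ?thesis
  proof eventually_elim
    case (elim X)
    then show ?case
      using norm_tendsto_infinity_of_direction[of X \<nu>] \<nu> by (auto simp: escape_dir_def)
  qed
qed

subsection \<open>The annealed walk\<close>

text \<open>The annealed law of the path alone. It is a law on sequences over a countable type, so
  \<open>prefix_zero_law\<close> applies to it.\<close>

definition path_law ::
    "(int ^ 'd \<Rightarrow> real) measure \<Rightarrow> int ^ 'd \<Rightarrow> (nat \<Rightarrow> int ^ 'd::finite) measure" where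
  "path_law \<mu> x = distr (annealed \<mu> x) path_space snd"

text \<open>The form \<open>range X \<subseteq> H\<close> is the one that
  \<open>quenched_local\<close> takes. The site \<open>x\<close> only fixes the level; the event
  does not prescribe where the path starts.\<close>

definition stays_above :: "real ^ 'd \<Rightarrow> int ^ 'd \<Rightarrow> (nat \<Rightarrow> int ^ 'd) set" where
  "stays_above l x = {X. range X \<subseteq> {z. l \<bullet> real_vec x \<le> l \<bullet> real_vec z}}"

lemma stays_above_sets [simp]: "stays_above l x \<in> sets path_space"
proof -
  have "stays_above l x = {X \<in> space path_space. \<forall>n. X n \<in> {z. l \<bullet> real_vec x \<le> l \<bullet> real_vec z}}"
    by (auto simp: stays_above_def)
  also have "\<dots> \<in> sets path_space" by measurable
  finally show ?thesis .
qed

lemma escape_above_sets: "escape_dir \<nu> \<inter> stays_above l x \<in> sets path_space"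
  by (intro sets.Int) auto

context
  fixes \<mu> :: "(int ^ 'd \<Rightarrow> real) measure"
  assumes \<mu>: "prob_space \<mu>" "sets \<mu> = sets prob_vector_space"
begin

lemma space_env_law: "space (env_law \<mu>) = space env_space"
  using sets_env_law[OF \<mu>] by (rule sets_eq_imp_space_eq)

lemma measurable_emeasure_quenched:
  assumes "A \<in> sets path_space"
  shows "(\<lambda>\<omega>. emeasure (quenched \<omega> x) A) \<in> borel_measurable (env_law \<mu>)"
  unfolding measurable_cong_sets[OF sets_env_law[OF \<mu>] refl]
  using measurable_emeasure_kernel[OF measurable_prob_algebraD[OF measurable_quenched] assms] .

lemma measurable_snd_annealed: "snd \<in> measurable (annealed \<mu> x) path_space"
  unfolding measurable_cong_sets[OF sets_annealed[OF \<mu>] refl] by (rule measurable_snd)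

lemma prob_space_path_law: "prob_space (path_law \<mu> x)"
  unfolding path_law_def
  by (rule prob_space.prob_space_distr[OF prob_space_annealed[OF \<mu>] measurable_snd_annealed])

lemma sets_path_law: "sets (path_law \<mu> x) = sets path_space"
  by (simp add: path_law_def)

lemma emeasure_path_law:
  assumes A: "A \<in> sets path_space"
  shows "emeasure (path_law \<mu> x) A = (\<integral>\<^sup>+\<omega>. emeasure (quenched \<omega> x) A \<partial>env_law \<mu>)"
proof -
  have sp: "space (annealed \<mu> x) = space (env_space \<Otimes>\<^sub>M path_space)"
    using sets_annealed[OF \<mu>] by (rule sets_eq_imp_space_eq)
  have "emeasure (path_law \<mu> x) A = emeasure (annealed \<mu> x) (snd -` A \<inter> space (env_space \<Otimes>\<^sub>M path_space))"
    unfolding path_law_def using emeasure_distr[OF measurable_snd_annealed A] sp by simp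
  also have "\<dots> = (\<integral>\<^sup>+\<omega>. emeasure (quenched \<omega> x) (Pair \<omega> -` (snd -` A \<inter> space (env_space \<Otimes>\<^sub>M path_space))) \<partial>env_law \<mu>)"
    by (rule emeasure_annealed[OF \<mu> measurable_sets[OF measurable_snd A]])
  also have "\<dots> = (\<integral>\<^sup>+\<omega>. emeasure (quenched \<omega> x) A \<partial>env_law \<mu>)"
    by (intro nn_integral_cong arg_cong2[where f=emeasure])
       (auto simp: space_env_law space_pair_measure)
  finally show ?thesis .
qed

section \<open>Translation invariance of the path law\<close>

lemma env_law_translate:
  "distr (env_law \<mu>) (env_law \<mu>) (\<lambda>\<omega> z. \<omega> (z + v)) = env_law \<mu>"
  using distr_PiM_reindex[of UNIV "\<lambda>_. \<mu>" "\<lambda>z. z + v" UNIV] \<mu>(1)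
  by (simp add: env_law_def inj_on_def restrict_def)

text \<open>Moving the starting point amounts to moving the environment, and the i.i.d. environment
  law is translation invariant.\<close>

lemma path_law_translate:
  assumes A: "A \<in> sets path_space"
  shows "emeasure (path_law \<mu> (x + v)) A = emeasure (path_law \<mu> x) ((\<lambda>X n. X n + v) -` A)"
proof -
  let ?t = "\<lambda>X n. X n + v :: int ^ 'd" and ?s = "\<lambda>\<omega> z. \<omega> (z + v) :: int ^ 'd \<Rightarrow> real"
  have t: "?t \<in> measurable path_space path_space"
    by (intro measurable_PiM_single') auto
  have tA: "?t -` A \<in> sets path_space" using measurable_sets[OF t A] by simp
  have s: "?s \<in> measurable (env_law \<mu>) (env_law \<mu>)"
    unfolding env_law_def by (intro measurable_PiM_single') (auto simp: space_PiM PiE_iff intro: measurable_component_singleton)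
  have "emeasure (path_law \<mu> (x + v)) A = (\<integral>\<^sup>+\<omega>. emeasure (quenched (?s \<omega>) x) (?t -` A) \<partial>env_law \<mu>)"
    unfolding emeasure_path_law[OF A]
  proof (rule nn_integral_cong)
    fix \<omega> assume "\<omega> \<in> space (env_law \<mu>)"
    then have "\<omega> z \<in> prob_vectors" for z by (simp add: space_env_law space_env_space)
    then show "emeasure (quenched \<omega> (x + v)) A = emeasure (quenched (?s \<omega>) x) (?t -` A)"
      using A by (rule quenched_translate)
  qed
  also have "\<dots> = (\<integral>\<^sup>+\<omega>. emeasure (quenched \<omega> x) (?t -` A) \<partial>distr (env_law \<mu>) (env_law \<mu>) ?s)"
    by (rule nn_integral_distr[OF s, symmetric]) (simp add: measurable_emeasure_quenched[OF tA])
  also have "\<dots> = emeasure (path_law \<mu> x) (?t -` A)"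
    unfolding env_law_translate emeasure_path_law[OF tA] ..
  finally show ?thesis .
qed

section \<open>Restarting the annealed walk after a prefix\<close>

lemma vimage_shift_sets:
  assumes "A \<in> sets path_space"
  shows "(\<lambda>X k. X (m + k)) -` A \<in> sets (path_space :: (nat \<Rightarrow> int ^ 'd) measure)"
  using measurable_sets[OF measurable_shift assms] by simp

text \<open>Both quenched factors see the same environment, so in general the integral does not
  split: the annealed walk need not be a Markov chain.\<close>

lemma path_law_markov:
  assumes A: "A \<in> sets path_space"
  shows "emeasure (path_law \<mu> x) (cylinder (y # w) \<inter> (\<lambda>X k. X (length w + k)) -` A) =
    (\<integral>\<^sup>+\<omega>. emeasure (quenched \<omega> x) (cylinder (y # w)) * emeasure (quenched \<omega> (last (y # w))) A \<partial>env_law \<mu>)"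
proof -
  have c: "cylinder (y # w) \<inter> (\<lambda>X k. X (length w + k)) -` A \<in> sets path_space"
    using vimage_shift_sets[OF A] by (intro sets.Int) auto
  show ?thesis
    unfolding emeasure_path_law[OF c]
    by (intro nn_integral_cong quenched_markov[OF _ A]) (simp add: space_env_law space_env_space)
qed

text \<open>Bounding the first factor by 1 suffices to carry null events of the restarted walk back
  to the original one.\<close>

lemma path_law_markov_le:
  assumes A: "A \<in> sets path_space"
  shows "emeasure (path_law \<mu> x) (cylinder (y # w) \<inter> (\<lambda>X k. X (length w + k)) -` A) \<le>
    emeasure (path_law \<mu> (last (y # w))) A"
  unfolding path_law_markov[OF A] emeasure_path_law[OF A]
proof (rule nn_integral_mono)
  fix \<omega> assume "\<omega> \<in> space (env_law \<mu>)"
  then have "\<omega> z \<in> prob_vectors" for z by (simp add: space_env_law space_env_space)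
  then have "prob_space (quenched \<omega> x)" by (rule prob_space_quenched)
  then have "emeasure (quenched \<omega> x) (cylinder (y # w)) \<le> 1" by (rule prob_space.emeasure_le_1)
  from mult_right_mono[OF this, of "emeasure (quenched \<omega> (last (y # w))) A"]
  show "emeasure (quenched \<omega> x) (cylinder (y # w)) * emeasure (quenched \<omega> (last (y # w))) A \<le>
      emeasure (quenched \<omega> (last (y # w))) A" by simp
qed

text \<open>The prefix consults the environment only at the sites before its last letter, all
  outside \<open>H\<close>, and \<open>A\<close> consults it only inside \<open>H\<close>. The two
  factors are therefore independent.\<close>

lemma path_law_renewal:
  assumes A: "A \<in> sets path_space" "A \<subseteq> {X. range X \<subseteq> H}" and disj: "set (butlast (y # w)) \<inter> H = {}"
  shows "emeasure (path_law \<mu> x) (cylinder (y # w) \<inter> (\<lambda>X k. X (length w + k)) -` A) =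
    emeasure (path_law \<mu> x) (cylinder (y # w)) * emeasure (path_law \<mu> (last (y # w))) A"
  unfolding path_law_markov[OF A(1)] emeasure_path_law[OF A(1)] emeasure_path_law[OF cylinder_sets]
  unfolding env_law_def
proof (rule nn_integral_PiM_mult_disjoint[where A = "- H"])
  show "prob_space \<mu>" by (rule \<mu>)
  show "(\<lambda>\<omega>. emeasure (quenched \<omega> x) (cylinder (y # w))) \<in> borel_measurable (PiM UNIV (\<lambda>_. \<mu>))"
    "(\<lambda>\<omega>. emeasure (quenched \<omega> (last (y # w))) A) \<in> borel_measurable (PiM UNIV (\<lambda>_. \<mu>))"
    using measurable_emeasure_quenched[OF cylinder_sets] measurable_emeasure_quenched[OF A(1)]
    unfolding env_law_def by auto
  have sp: "\<omega> z \<in> prob_vectors" if "\<omega> \<in> space (PiM UNIV (\<lambda>_. \<mu>))" for \<omega> :: "'d env" and z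
    using that space_env_law space_env_space[of \<omega>] unfolding env_law_def by blast
  fix \<omega> \<omega>' :: "'d env" assume \<omega>: "\<omega> \<in> space (PiM UNIV (\<lambda>_. \<mu>))" "\<omega>' \<in> space (PiM UNIV (\<lambda>_. \<mu>))"
  {
    assume eq: "\<And>z. z \<in> - H \<Longrightarrow> \<omega> z = \<omega>' z"
    have "path_weight \<omega> y w = path_weight \<omega>' y w"
      using disj by (intro path_weight_cong eq) blast
    then show "emeasure (quenched \<omega> x) (cylinder (y # w)) = emeasure (quenched \<omega>' x) (cylinder (y # w))"
      by (auto simp: quenched_cylinder_Cons sp[OF \<omega>(1)] sp[OF \<omega>(2)])
  next
    assume "\<And>z. z \<notin> - H \<Longrightarrow> \<omega> z = \<omega>' z"
    then show "emeasure (quenched \<omega> (last (y # w))) A = emeasure (quenched \<omega>' (last (y # w))) A"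
      by (intro quenched_local[OF _ _ _ A] sp \<omega>) auto
  }
qed

section \<open>Escape within a half-space and its consequences\<close>

lemma path_law_escape_above:
  assumes \<nu>: "norm \<nu> = 1"
  shows "emeasure (path_law \<mu> x) (escape_dir \<nu> \<inter> stays_above l x) =
    emeasure (path_law \<mu> 0) (escape_dir \<nu> \<inter> stays_above l 0)"
proof -
  have "(\<lambda>X n. X n + x) -` (escape_dir \<nu> \<inter> stays_above l x) = escape_dir \<nu> \<inter> stays_above l 0"
    using escape_dir_translate[OF \<nu>]
    by (auto simp: stays_above_def real_vec_add inner_add_right image_subset_iff)
  then show ?thesis
    using path_law_translate[OF escape_above_sets, of 0 x \<nu> l x] by simp
qed

text \<open>On the escape event \<open>l \<bullet> real_vec (X n)\<close> attains its minimum, and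
  from that time on the path escapes above its current level. There are countably many prefixes up
  to the minimum, so if escaping above the start were null, escaping at all would be null.\<close>

lemma path_law_escape_above_pos:
  assumes \<nu>: "norm \<nu> = 1" and l: "l \<bullet> \<nu> > 0" and pos: "emeasure (path_law \<mu> 0) (escape_dir \<nu>) > 0"
  shows "emeasure (path_law \<mu> 0) (escape_dir \<nu> \<inter> stays_above l 0) > 0"
proof (rule ccontr)
  assume "\<not> emeasure (path_law \<mu> 0) (escape_dir \<nu> \<inter> stays_above l 0) > 0"
  then have zero: "emeasure (path_law \<mu> x) (escape_dir \<nu> \<inter> stays_above l x) = 0" for x
    using path_law_escape_above[OF \<nu>, of x l] by (simp add: zero_less_iff_neq_zero)
  \<comment> \<open>\<open>length w - 1\<close> is the time of the last letter, so the restarted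
    path begins at \<open>last w\<close>; the union below runs over nonempty words only.\<close>
  define B where "B w = cylinder w \<inter> (\<lambda>X k. X (length w - 1 + k)) -` (escape_dir \<nu> \<inter> stays_above l (last w))"
    for w :: "(int ^ 'd) list"
  have "B w \<in> null_sets (path_law \<mu> 0)" if ne: "w \<noteq> []" for w
  proof (rule null_setsI)
    obtain y u where w: "w = y # u" using ne by (meson neq_Nil_conv)
    show "emeasure (path_law \<mu> 0) (B w) = 0"
      using path_law_markov_le[OF escape_above_sets, of 0 y u \<nu> l "last w"] zero[of "last w"]
      unfolding B_def w by simp
    show "B w \<in> sets (path_law \<mu> 0)"
      unfolding B_def sets_path_law by (intro sets.Int[OF cylinder_sets] vimage_shift_sets escape_above_sets)
  qed
  then have "(\<Union>w\<in>{w. w \<noteq> []}. B w) \<in> null_sets (path_law \<mu> 0)"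
    by (intro null_sets_UN') auto
  moreover have "escape_dir \<nu> \<subseteq> (\<Union>w\<in>{w. w \<noteq> []}. B w)"
  proof
    fix X assume X: "X \<in> escape_dir \<nu>"
    obtain m where m: "\<And>n. l \<bullet> real_vec (X m) \<le> l \<bullet> real_vec (X n)"
      using exists_global_minimum[OF escape_dir_inner_at_top[OF X l]] by blast
    have "X \<in> B (map X [0..<Suc m])"
      using X m cylinder_prefix[of X "Suc m"]
      by (auto simp: B_def escape_dir_shift stays_above_def)
    then show "X \<in> (\<Union>w\<in>{w. w \<noteq> []}. B w)" by (intro UN_I[of "map X [0..<Suc m]"]) auto
  qed
  ultimately have "emeasure (path_law \<mu> 0) (escape_dir \<nu>) = 0"
    by (metis emeasure_eq_0 null_setsD1 null_setsD2)
  with pos show False by simp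
qed

text \<open>\<open>prefix_zero_law\<close> is applied with \<open>R\<close> saying that the prefix
  ends at a strict record in direction \<open>l\<close>. The earlier sites then lie strictly below
  the half-space at the record, so by renewal and translation the walk goes on to escape in
  direction \<open>\<nu>'\<close> above that level with conditional probability exactly
  \<open>\<delta>\<close>; such a path cannot have direction \<open>\<nu>\<close>.\<close>

lemma path_law_escape_eq_0:
  assumes "norm \<nu>' = 1" and "\<nu> \<noteq> \<nu>'" and l: "l \<bullet> \<nu> > 0" "l \<bullet> \<nu>' > 0"
    and pos: "emeasure (path_law \<mu> 0) (escape_dir \<nu>') > 0"
  shows "measure (path_law \<mu> 0) (escape_dir \<nu>) = 0"
proof -
  interpret prob_space "path_law \<mu> 0" by (rule prob_space_path_law)
  define \<delta> where "\<delta> = measure (path_law \<mu> 0) (escape_dir \<nu>' \<inter> stays_above l 0)"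
  have "\<delta> > 0"
    using path_law_escape_above_pos[OF assms(1) l(2) pos] by (simp add: \<delta>_def emeasure_eq_measure)
  show ?thesis
  proof (rule prefix_zero_law[where R = "\<lambda>w. w \<noteq> [] \<and> (\<forall>z\<in>set (butlast w). l \<bullet> real_vec z < l \<bullet> real_vec (last w))",
        OF _ sets_path_law _ \<open>\<delta> > 0\<close>])
    show "finite_measure (path_law \<mu> 0)" by unfold_locales
    show "escape_dir \<nu> \<in> sets (path_law \<mu> 0)" by (simp add: sets_path_law)
    fix X N assume "X \<in> escape_dir \<nu>"
    then obtain n where "n \<ge> N" "\<And>j. j < n \<Longrightarrow> l \<bullet> real_vec (X j) < l \<bullet> real_vec (X n)"
      using strict_record_exists[OF escape_dir_inner_at_top[OF _ l(1)]] by metis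
    then show "\<exists>n\<ge>N. map X [0..<n] \<noteq> [] \<and>
        (\<forall>z\<in>set (butlast (map X [0..<n])). l \<bullet> real_vec z < l \<bullet> real_vec (last (map X [0..<n])))"
      by (intro exI[of _ "Suc n"]) auto
  next
    fix w assume R: "w \<noteq> [] \<and> (\<forall>z\<in>set (butlast w). l \<bullet> real_vec z < l \<bullet> real_vec (last w))"
    then obtain y u where w: "w = y # u" by (meson neq_Nil_conv)
    let ?A = "escape_dir \<nu>' \<inter> stays_above l (last w)"
    let ?B = "cylinder w \<inter> (\<lambda>X k. X (length u + k)) -` ?A"
    have "emeasure (path_law \<mu> 0) ?B = emeasure (path_law \<mu> 0) (cylinder w) * emeasure (path_law \<mu> (last w)) ?A"
      unfolding w
    proof (rule path_law_renewal)
      show "escape_dir \<nu>' \<inter> stays_above l (last (y # u)) \<in> sets path_space"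
        by (rule escape_above_sets)
      show "escape_dir \<nu>' \<inter> stays_above l (last (y # u)) \<subseteq>
          {X. range X \<subseteq> {z. l \<bullet> real_vec (last (y # u)) \<le> l \<bullet> real_vec z}}"
        by (auto simp: stays_above_def)
      show "set (butlast (y # u)) \<inter> {z. l \<bullet> real_vec (last (y # u)) \<le> l \<bullet> real_vec z} = {}"
        using R unfolding w by force
    qed
    then have "\<delta> * measure (path_law \<mu> 0) (cylinder w) = measure (path_law \<mu> 0) ?B"
      unfolding path_law_escape_above[OF assms(1), of "last w" l]
      by (simp add: \<delta>_def emeasure_eq_measure mult.commute flip: ennreal_mult')
    also have "?B \<subseteq> cylinder w - escape_dir \<nu>"
    proof
      fix X assume "X \<in> ?B"
      then have "X \<in> cylinder w" "X \<in> escape_dir \<nu>'" by (auto simp: escape_dir_shift)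
      moreover from this have "X \<notin> escape_dir \<nu>"
        using \<open>\<nu> \<noteq> \<nu>'\<close> LIMSEQ_unique unfolding escape_dir_def by blast
      ultimately show "X \<in> cylinder w - escape_dir \<nu>" by simp
    qed
    then have "measure (path_law \<mu> 0) ?B \<le> measure (path_law \<mu> 0) (cylinder w - escape_dir \<nu>)"
      by (intro finite_measure_mono) (auto simp: sets_path_law)
    finally show "\<delta> * measure (path_law \<mu> 0) (cylinder w) \<le> measure (path_law \<mu> 0) (cylinder w - escape_dir \<nu>)" .
  qed
qed

text \<open>This is where ellipticity enters: almost every environment is positive at all sites and
  in all steps, and there a walk with an asymptotic direction escapes almost surely.\<close>

lemma limit_dir_event_le_escape:
  assumes ell: "strictly_elliptic \<mu>" and \<nu>: "norm \<nu> = 1"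
  shows "emeasure (annealed \<mu> x) (limit_dir_event \<nu>) \<le> emeasure (path_law \<mu> x) (escape_dir \<nu>)"
proof -
  have "AE \<omega> in env_law \<mu>. \<forall>z. \<forall>e. e \<in> unit_vecs \<longrightarrow> 0 < \<omega> z e"
    unfolding AE_all_countable
  proof (intro allI)
    fix z e :: "int ^ 'd"
    show "AE \<omega> in env_law \<mu>. e \<in> unit_vecs \<longrightarrow> 0 < \<omega> z e"
    proof (cases "e \<in> unit_vecs")
      case True
      \<comment> \<open>Ellipticity is assumed at the origin; at \<open>z\<close> it follows from
        that of the translated environment, which has the same law.\<close>
      have "AE \<omega> in distr (env_law \<mu>) (env_law \<mu>) (\<lambda>\<omega> z'. \<omega> (z' + z)). 0 < \<omega> 0 e"
        unfolding env_law_translate using ell True by (simp add: strictly_elliptic_def)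
      then have "AE \<omega> in env_law \<mu>. 0 < \<omega> (0 + z) e"
        by (rule AE_distrD[rotated])
           (auto simp: env_law_def space_PiM PiE_iff intro!: measurable_PiM_single' measurable_component_singleton)
      then show ?thesis by simp
    qed simp
  qed
  moreover have "AE \<omega> in env_law \<mu>. \<omega> \<in> space (env_law \<mu>)" by (rule AE_space)
  ultimately have "AE \<omega> in env_law \<mu>. emeasure (quenched \<omega> x) (Pair \<omega> -` limit_dir_event \<nu>) \<le>
      emeasure (quenched \<omega> x) (escape_dir \<nu>)"
  proof eventually_elim
    case (elim \<omega>)
    then have \<omega>: "\<omega> z \<in> prob_vectors" for z by (simp add: space_env_law space_env_space)
    have "AE X in quenched \<omega> x. X \<in> Pair \<omega> -` limit_dir_event \<nu> \<longrightarrow> X \<in> escape_dir \<nu>"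
      using AE_quenched_direction_imp_escape[of \<omega> \<nu> x, OF \<omega> _ \<nu>] elim
      by (auto simp: limit_dir_event_def sgn_div_norm)
    then show ?case
      by (rule emeasure_mono_AE) (simp add: sets_quenched[of \<omega>, OF \<omega>])
  qed
  then show ?thesis
    unfolding emeasure_annealed[OF \<mu> sets_limit_dir_event] emeasure_path_law[OF escape_dir_sets]
    by (rule nn_integral_mono_AE)
qed

end

theorem proposition1:
  fixes \<mu> :: "(int ^ 'd \<Rightarrow> real) measure" and \<nu> \<nu>' :: "real ^ 'd"
  assumes "prob_space \<mu>" and "sets \<mu> = sets prob_vector_space"
    and "strictly_elliptic \<mu>"
    and "norm \<nu> = 1" and "norm \<nu>' = 1" and "\<nu> \<noteq> \<nu>'"
    and "measure (annealed \<mu> 0) (limit_dir_event \<nu>) *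
         measure (annealed \<mu> 0) (limit_dir_event \<nu>') > 0"
  shows "\<nu>' = - \<nu>"
proof (rule ccontr)
  assume "\<nu>' \<noteq> - \<nu>"
  then have "\<nu> + \<nu>' \<noteq> 0" by (metis add_eq_0_iff)
  then have "(\<nu> + \<nu>') \<bullet> (\<nu> + \<nu>') > 0" by simp
  moreover have "\<nu> \<bullet> \<nu> = 1" "\<nu>' \<bullet> \<nu>' = 1" using assms(4,5) by (simp_all add: norm_eq_1)
  \<comment> \<open>Both products equal \<open>1 + \<nu> \<bullet> \<nu>'\<close>, which is half of
    \<open>(\<nu> + \<nu>') \<bullet> (\<nu> + \<nu>')\<close>.\<close>
  ultimately have l: "(\<nu> + \<nu>') \<bullet> \<nu> > 0" "(\<nu> + \<nu>') \<bullet> \<nu>' > 0"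
    by (simp_all add: inner_add_left inner_add_right inner_commute)
  interpret P: prob_space "annealed \<mu> 0" by (rule prob_space_annealed[OF assms(1,2)])
  interpret Q: prob_space "path_law \<mu> 0" by (rule prob_space_path_law[OF assms(1,2)])
  have "measure (path_law \<mu> 0) (escape_dir \<nu>) > 0 \<and> measure (path_law \<mu> 0) (escape_dir \<nu>') > 0"
    using assms(7) limit_dir_event_le_escape[OF assms(1-3), of \<nu> 0] limit_dir_event_le_escape[OF assms(1-3), of \<nu>' 0]
      assms(4,5) by (auto simp: P.emeasure_eq_measure Q.emeasure_eq_measure zero_less_mult_iff not_le
        intro: order.strict_trans2 dest: order.strict_trans1[OF measure_nonneg])
  moreover from this have "measure (path_law \<mu> 0) (escape_dir \<nu>) = 0"
    using assms(5,6) l by (intro path_law_escape_eq_0[OF assms(1,2), where \<nu>' = \<nu>' and l = "\<nu> + \<nu>'"]) (auto simp: Q.emeasure_eq_measure)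
  ultimately show False by simp
qed

end
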